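(* Consider a problem class with cardinality bounds $\underline p,\bar p$ such that $\bar p(n)\le C n^{1-\delta}$ for all $n$, where $\delta\in(0,1]$ and $C>0$, and with cost bounds $0<m_\infty\le M_\infty$. Let $k=n-l$ with $l\in[n-1]$ and let $\varepsilon>0$. If all parameters $M_\infty,\delta,C,\varepsilon$ and $l$ are fixed, then an optimal solution of the min-max-min robust problem $(\mathrm M^3(k))$ up to an additive error of $\varepsilon$ (i.e. $x^{(1)},\dots,x^{(k)}\in X$ with objective value at most $\mathrm{opt}(k)+\varepsilon$) can be calculated in (oracle-)polynomial time in $n$.
   Context: Notation: $\mathbb N=\{1,2,\dots\}$, $[k]=\{1,\dots,k\}$, $\mathbb R_+^n=\{x\in\mathbb R^n: x\ge 0\}$, and $\|x\|_0$ is the number of non-zero entries of $x$. An instance of dimension $n$ consists of a nonempty set $X\subseteq\{0,1\}^n$ and a nonempty convex set $U\subseteq\mathbb R_+^n$; all minima and maxima written are understood to be attained (e.g. $U$ compact). For $k\in\mathbb N$ the min-max-min robust problem $(\mathrm M^3(k))$ is $$\min_{x^{(1)},\dots,x^{(k)}\in X}\ \max_{c\in U}\ \min_{i=1,\dots,k} c^\top x^{(i)},$$ the objective value of $x^{(1)},\dots,x^{(k)}$ is $\max_{c\in U}\min_{i} c^\top x^{(i)}$, and $\mathrm{opt}(k)$ denotes the optimal value. A problem class has cardinality bounds $\underline p,\bar p:\mathbb N\to\mathbb R_+$ if for every instance of dimension $n$ in the class $\underline p(n)\le\|x\|_0\le\bar p(n)$ for all $x\in X$. Here, cost bounds $0<m_\infty\le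 M_\infty$ means that $m_\infty\le\|c\|_\infty\le M_\infty$ for all $c\in U$. Computational model: the set $X$ is accessed through an oracle which, for a cost vector $c\in\mathbb R^n$, returns an optimal solution of $\min_{x\in X}c^\top x$ in constant time. Linear functions can be maximized over $U$ in polynomial time. As known from earlier work, $(\mathrm M^3(n))$ can then be solved in oracle-polynomial time. Moreover, for given points $x^1,\dots,x^r\in X$ with $r\le n$, the convex problem $\min_{x\in\mathrm{conv}\{x^1,\dots,x^r\}}\max_{c\in U}c^\top x$ can be solved in polynomial time. Oracle-polynomial means polynomial when each oracle call is counted as constant time. *)

theory Defs
  imports Complex_Main "HOL-Computational_Algebra.Polynomial" "Jordan_Normal_Form.Matrix"
begin

section \<open>The min-max-min robust problem\<close>

text \<open>Since the dimension varies within a problem class, vectors are of type \<^typ>\<open>real vec\<close>,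
  restricted to \<^term>\<open>carrier_vec n\<close>; indices run from 0 to n - 1.
  The list of reals \<open>descr\<close> is the data by which the set U is presented to an algorithm.\<close>

record m3_inst =
  inst_dim :: nat
  feas :: "real vec set"
  unc :: "real vec set"
  descr :: "real list"

definition convex_vec :: "real vec set \<Rightarrow> bool" where
  "convex_vec U \<longleftrightarrow> (\<forall>a\<in>U. \<forall>b\<in>U. \<forall>t. 0 \<le> t \<and> t \<le> 1 \<longrightarrow> (1 - t) \<cdot>\<^sub>v a + t \<cdot>\<^sub>v b \<in> U)"

definition conv_vecs :: "nat \<Rightarrow> real vec list \<Rightarrow> real vec set" where
  "conv_vecs n xs = {vec n (\<lambda>j. \<Sum>i<length xs. w i * (xs ! i) $ j) | w :: nat \<Rightarrow> real.
     (\<forall>i<length xs. 0 \<le> w i) \<and> (\<Sum>i<length xs. w i) = 1}"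

definition norm0 :: "real vec \<Rightarrow> nat" where
  "norm0 x = card {i. i < dim_vec x \<and> x $ i \<noteq> 0}"

definition norm_inf :: "real vec \<Rightarrow> real" where
  "norm_inf c = Max {\<bar>c $ i\<bar> | i. i < dim_vec c}"

definition min_cost :: "real vec list \<Rightarrow> real vec \<Rightarrow> real" where
  "min_cost xs c = Min {c \<bullet> x | x. x \<in> set xs}"

definition attains_max :: "(real vec \<Rightarrow> real) \<Rightarrow> real vec set \<Rightarrow> bool" where
  "attains_max f U \<longleftrightarrow> (\<exists>c\<in>U. \<forall>c'\<in>U. f c' \<le> f c)"

text \<open>The last two conditions say that the maxima over U exist. They hold if U is compact.\<close>

definition valid_inst :: "m3_inst \<Rightarrow> bool" where
  "valid_inst I \<longleftrightarrow> 1 \<le> inst_dim I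
     \<and> feas I \<noteq> {} \<and> feas I \<subseteq> {x \<in> carrier_vec (inst_dim I). \<forall>i<inst_dim I. x $ i \<in> {0, 1}}
     \<and> unc I \<noteq> {} \<and> unc I \<subseteq> {c \<in> carrier_vec (inst_dim I). \<forall>i<inst_dim I. 0 \<le> c $ i}
     \<and> convex_vec (unc I)
     \<and> (\<forall>a\<in>carrier_vec (inst_dim I). attains_max (\<lambda>c. a \<bullet> c) (unc I))
     \<and> (\<forall>xs. xs \<noteq> [] \<and> set xs \<subseteq> feas I \<longrightarrow> attains_max (min_cost xs) (unc I))"

text \<open>For nonempty xs the supremum in \<open>objective\<close> is a maximum, by \<^const>\<open>valid_inst\<close>; the minimum
  in \<open>opt\<close> ranges over finitely many lists.\<close>

definition objective :: "m3_inst \<Rightarrow> real vec list \<Rightarrow> real" where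
  "objective I xs = (SUP c\<in>unc I. min_cost xs c)"

definition solutions :: "m3_inst \<Rightarrow> nat \<Rightarrow> real vec list set" where
  "solutions I k = {xs. length xs = k \<and> set xs \<subseteq> feas I}"

definition opt :: "m3_inst \<Rightarrow> nat \<Rightarrow> real" where
  "opt I k = Min (objective I ` solutions I k)"

definition max_cost :: "m3_inst \<Rightarrow> real vec \<Rightarrow> real" where
  "max_cost I x = (SUP c\<in>unc I. c \<bullet> x)"

definition card_bounds :: "m3_inst set \<Rightarrow> (nat \<Rightarrow> real) \<Rightarrow> (nat \<Rightarrow> real) \<Rightarrow> bool" where
  "card_bounds \<C> p_lo p_up \<longleftrightarrow> (\<forall>n\<ge>1. 0 \<le> p_lo n \<and> 0 \<le> p_up n)
     \<and> (\<forall>I\<in>\<C>. \<forall>x\<in>feas I. p_lo (inst_dim I) \<le> real (norm0 x) \<and> real (norm0 x) \<le> p_up (inst_dim I))"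

definition cost_bounds :: "m3_inst set \<Rightarrow> real \<Rightarrow> real \<Rightarrow> bool" where
  "cost_bounds \<C> m M \<longleftrightarrow> 0 < m \<and> m \<le> M
     \<and> (\<forall>I\<in>\<C>. \<forall>c\<in>unc I. m \<le> norm_inf c \<and> norm_inf c \<le> M)"


section \<open>Real RAM programs with an oracle\<close>

text \<open>A program is a finite text whose only constants are natural numbers. The memory consists
  of registers holding natural numbers and of arrays of real numbers, where array indices may be
  computed. Every assignment, test and oracle call takes one time step; an expression has fixed
  size in a given program. There is neither rounding nor conversion from reals to naturals.
  \<open>Descr e\<close> reads an entry of the description of the uncertainty set, yielding 0 beyond its end.\<close>

datatype nexp = NConst nat | NReg nat | NAdd nexp nexp | NSub nexp nexp | NMul nexp nexp

datatype rexp = RNat nexp | RCell nat nexp | Descr nexp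
  | RAdd rexp rexp | RSub rexp rexp | RMul rexp rexp | RDiv rexp rexp

datatype bexp = NLess nexp nexp | RLess rexp rexp | BNot bexp | BAnd bexp bexp

datatype com = Skip
  | NAssign nat nexp
  | RAssign nat nexp rexp
  | Oracle nat nat
  | Seq com com
  | Cond bexp com com
  | While bexp com

record store =
  nreg :: "nat \<Rightarrow> nat"
  arr :: "nat \<Rightarrow> nat \<Rightarrow> real"

primrec nval :: "nexp \<Rightarrow> store \<Rightarrow> nat" where
  "nval (NConst a) s = a"
| "nval (NReg v) s = nreg s v"
| "nval (NAdd e f) s = nval e s + nval f s"
| "nval (NSub e f) s = nval e s - nval f s"
| "nval (NMul e f) s = nval e s * nval f s"

primrec rval :: "real list \<Rightarrow> rexp \<Rightarrow> store \<Rightarrow> real" where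
  "rval d (RNat e) s = real (nval e s)"
| "rval d (RCell a e) s = arr s a (nval e s)"
| "rval d (Descr e) s = nth_default 0 d (nval e s)"
| "rval d (RAdd e f) s = rval d e s + rval d f s"
| "rval d (RSub e f) s = rval d e s - rval d f s"
| "rval d (RMul e f) s = rval d e s * rval d f s"
| "rval d (RDiv e f) s = rval d e s / rval d f s"

primrec bval :: "real list \<Rightarrow> bexp \<Rightarrow> store \<Rightarrow> bool" where
  "bval d (NLess e f) s \<longleftrightarrow> nval e s < nval f s"
| "bval d (RLess e f) s \<longleftrightarrow> rval d e s < rval d f s"
| "bval d (BNot b) s \<longleftrightarrow> \<not> bval d b s"
| "bval d (BAnd b c) s \<longleftrightarrow> bval d b s \<and> bval d c s"

definition set_nreg :: "nat \<Rightarrow> nat \<Rightarrow> store \<Rightarrow> store" where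
  "set_nreg v a s = s\<lparr>nreg := (nreg s)(v := a)\<rparr>"

definition set_cell :: "nat \<Rightarrow> nat \<Rightarrow> real \<Rightarrow> store \<Rightarrow> store" where
  "set_cell a i y s = s\<lparr>arr := (arr s)(a := (arr s a)(i := y))\<rparr>"

text \<open>Vectors are stored consecutively: vector number i occupies the cells i * n, ..., i * n + n - 1.\<close>

definition row_at :: "nat \<Rightarrow> store \<Rightarrow> nat \<Rightarrow> nat \<Rightarrow> real vec" where
  "row_at n s a i = vec n (\<lambda>j. arr s a (i * n + j))"

definition rows_at :: "nat \<Rightarrow> store \<Rightarrow> nat \<Rightarrow> nat \<Rightarrow> real vec list" where
  "rows_at n s a k = map (row_at n s a) [0..<k]"

definition store_vec :: "nat \<Rightarrow> nat \<Rightarrow> real vec \<Rightarrow> store \<Rightarrow> store" where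
  "store_vec n a x s = s\<lparr>arr := (arr s)(a := (\<lambda>i. if i < n then x $ i else arr s a i))\<rparr>"

text \<open>\<open>exec n d \<O> P s t s'\<close>: in dimension n, with description d and oracle \<open>\<O>\<close>, program P started
  in s halts in s' after t steps. \<open>Oracle a b\<close> queries the oracle with the vector at the beginning
  of array a and writes the answer to the beginning of array b.\<close>

inductive exec :: "nat \<Rightarrow> real list \<Rightarrow> (real vec \<Rightarrow> real vec) \<Rightarrow> com \<Rightarrow> store \<Rightarrow> nat \<Rightarrow> store \<Rightarrow> bool"
  for n :: nat and d :: "real list" and \<O> :: "real vec \<Rightarrow> real vec" where
  Skip: "exec n d \<O> Skip s 1 s"
| NAssign: "exec n d \<O> (NAssign v e) s 1 (set_nreg v (nval e s) s)"
| RAssign: "exec n d \<O> (RAssign a e f) s 1 (set_cell a (nval e s) (rval d f s) s)"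
| Oracle: "exec n d \<O> (Oracle a b) s 1 (store_vec n b (\<O> (row_at n s a 0)) s)"
| Seq: "exec n d \<O> P s t s' \<Longrightarrow> exec n d \<O> Q s' t' s'' \<Longrightarrow> exec n d \<O> (Seq P Q) s (t + t') s''"
| CondTrue: "bval d b s \<Longrightarrow> exec n d \<O> P s t s' \<Longrightarrow> exec n d \<O> (Cond b P Q) s (Suc t) s'"
| CondFalse: "\<not> bval d b s \<Longrightarrow> exec n d \<O> Q s t s' \<Longrightarrow> exec n d \<O> (Cond b P Q) s (Suc t) s'"
| WhileFalse: "\<not> bval d b s \<Longrightarrow> exec n d \<O> (While b P) s 1 s"
| WhileTrue: "bval d b s \<Longrightarrow> exec n d \<O> P s t s' \<Longrightarrow> exec n d \<O> (While b P) s' t' s''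
    \<Longrightarrow> exec n d \<O> (While b P) s (Suc (t + t')) s''"

primrec oracle_free :: "com \<Rightarrow> bool" where
  "oracle_free Skip \<longleftrightarrow> True"
| "oracle_free (NAssign v e) \<longleftrightarrow> True"
| "oracle_free (RAssign a e f) \<longleftrightarrow> True"
| "oracle_free (Oracle a b) \<longleftrightarrow> False"
| "oracle_free (Seq P Q) \<longleftrightarrow> oracle_free P \<and> oracle_free Q"
| "oracle_free (Cond b P Q) \<longleftrightarrow> oracle_free P \<and> oracle_free Q"
| "oracle_free (While b P) \<longleftrightarrow> oracle_free P"

definition valid_oracle :: "m3_inst \<Rightarrow> (real vec \<Rightarrow> real vec) \<Rightarrow> bool" where
  "valid_oracle I \<O> \<longleftrightarrow>
     (\<forall>c\<in>carrier_vec (inst_dim I). \<O> c \<in> feas I \<and> (\<forall>x\<in>feas I. c \<bullet> \<O> c \<le> c \<bullet> x))"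

text \<open>Correctness and the time bound q are required for every admissible oracle and every
  start store that has the dimension in register 0 and satisfies \<open>pre\<close>; the remaining memory is
  uninitialised, i.e. arbitrary.\<close>

definition computes :: "com \<Rightarrow> nat poly \<Rightarrow> m3_inst \<Rightarrow> (store \<Rightarrow> bool) \<Rightarrow> (store \<Rightarrow> store \<Rightarrow> bool) \<Rightarrow> bool"
  where
  "computes P q I pre post \<longleftrightarrow>
     (\<forall>\<O> s. valid_oracle I \<O> \<and> nreg s 0 = inst_dim I \<and> pre s \<longrightarrow>
        (\<exists>t s'. exec (inst_dim I) (descr I) \<O> P s t s' \<and> t \<le> poly q (inst_dim I) \<and> post s s'))"


section \<open>The computational problems\<close>

text \<open>Maximize over U the linear function whose coefficients are given at the beginning of array 0;
  output in array 1.\<close>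

definition lin_max_poly :: "m3_inst set \<Rightarrow> bool" where
  "lin_max_poly \<K> \<longleftrightarrow> (\<exists>P q. oracle_free P \<and> (\<forall>I\<in>\<K>. computes P q I (\<lambda>s. True)
     (\<lambda>s s'. let a = row_at (inst_dim I) s 0 0; c = row_at (inst_dim I) s' 1 0 in
        c \<in> unc I \<and> (\<forall>c'\<in>unc I. a \<bullet> c' \<le> a \<bullet> c))))"

text \<open>Solve the min-max-min problem with k = n; output in array 0.\<close>

definition m3_n_oracle_poly :: "m3_inst set \<Rightarrow> bool" where
  "m3_n_oracle_poly \<K> \<longleftrightarrow> (\<exists>P q. \<forall>I\<in>\<K>. computes P q I (\<lambda>s. True)
     (\<lambda>s s'. let xs = rows_at (inst_dim I) s' 0 (inst_dim I) in
        xs \<in> solutions I (inst_dim I) \<and> objective I xs = opt I (inst_dim I)))"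

text \<open>Minimize the worst-case cost over the convex hull of r feasible points, where r is given in
  register 1 and the points in array 0; the optimal solution is output in array 1.\<close>

definition conv_problem_poly :: "m3_inst set \<Rightarrow> bool" where
  "conv_problem_poly \<K> \<longleftrightarrow> (\<exists>P q. oracle_free P \<and> (\<forall>I\<in>\<K>. computes P q I
     (\<lambda>s. 1 \<le> nreg s 1 \<and> nreg s 1 \<le> inst_dim I \<and> set (rows_at (inst_dim I) s 0 (nreg s 1)) \<subseteq> feas I)
     (\<lambda>s s'. let K = conv_vecs (inst_dim I) (rows_at (inst_dim I) s 0 (nreg s 1)); x = row_at (inst_dim I) s' 1 0 in
        x \<in> K \<and> (\<forall>y\<in>K. max_cost I x \<le> max_cost I y))))"

text \<open>Solve the min-max-min problem with k solutions up to an additive error; output in array 0.\<close>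

definition approx_solves :: "com \<Rightarrow> nat poly \<Rightarrow> m3_inst \<Rightarrow> nat \<Rightarrow> real \<Rightarrow> bool" where
  "approx_solves P q I k \<epsilon> \<longleftrightarrow> computes P q I (\<lambda>s. True)
     (\<lambda>s s'. let xs = rows_at (inst_dim I) s' 0 k in
        xs \<in> solutions I k \<and> objective I xs \<le> opt I k + \<epsilon>)"

end

theory Submission
  imports Defs
begin

text \<open>By a minimax theorem, the objective value of a list of points is the least worst-case cost of a
  point in its convex hull, so it can be computed with the two subprograms for the convex problem and
  for linear maximization. Of r points, one has weight at most 1/r in an optimal convex combination,
  and leaving out this point costs at most M p(n) / r. Starting from an optimal solution for k = n and
  removing l times the point whose removal is cheapest, one loses at most l M C n^(1 - \<delta>) / (n - l + 1),
  which tends to 0. The finitely many dimensions in which this exceeds \<epsilon> are treated by enumerating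
  all k-tuples of feasible points.\<close>

section \<open>A theorem of the alternative\<close>

text \<open>The uncertainty set carries no topology here, only convexity and attained maxima. So the
  minimax theorem is obtained for finitely many affine functions, by induction on their number, from
  convexity alone. The loss of the greedy algorithm is measured against \<open>opt I n\<close>,
  which is at most \<open>opt I k\<close> because points may be repeated. The order of quantifiers
  shapes the rest: one program text and one polynomial serve all classes, instances and oracles. The
  dimension from which the loss is at most \<epsilon> depends on \<open>M\<close>,
  \<open>\<delta>\<close>, \<open>C\<close>, \<open>\<epsilon>\<close> and \<open>l\<close> only and
  enters the text as a natural number, so the program never handles these reals. Below this
  dimension the feasible set is still known through the oracle alone. Its points are therefore
  guessed: a 0/1 pattern is turned into costs, and whatever the oracle answers is feasible.\<close>

text \<open>Each point with \<open>f\<close> positive imposes a lower bound on \<open>t\<close>,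
  each point with \<open>g\<close> positive an upper bound. By \<open>cross\<close> no lower bound
  exceeds an upper one, so the supremum of the lower bounds serves as \<open>t\<close>. Convex
  combination is an abstract operation \<open>mix\<close> because vectors of all dimensions share
  the type \<open>real vec\<close>, which is no real vector space.\<close>

lemma affine_pair_alternative:
  fixes f g :: "'a \<Rightarrow> real"
  assumes mix: "\<And>a b t. a \<in> U \<Longrightarrow> b \<in> U \<Longrightarrow> 0 \<le> t \<Longrightarrow> t \<le> 1 \<Longrightarrow> mix t a b \<in> U"
    and f: "\<And>a b t. a \<in> U \<Longrightarrow> b \<in> U \<Longrightarrow> f (mix t a b) = (1 - t) * f a + t * f b"
    and g: "\<And>a b t. a \<in> U \<Longrightarrow> b \<in> U \<Longrightarrow> g (mix t a b) = (1 - t) * g a + t * g b"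
    and alt: "\<And>c. c \<in> U \<Longrightarrow> f c \<le> 0 \<or> g c \<le> 0"
  shows "\<exists>t. 0 \<le> t \<and> t \<le> 1 \<and> (\<forall>c\<in>U. (1 - t) * f c + t * g c \<le> 0)"
proof -
  \<comment> \<open>The element 0 makes \<open>L\<close> nonempty and its supremum non-negative even
    if \<open>f\<close> is nowhere positive.\<close>
  define L where "L = insert 0 {f c / (f c - g c) | c. c \<in> U \<and> f c > 0}"
  have cross: "f c * g d \<le> f d * g c" if c: "c \<in> U" "f c > 0" and d: "d \<in> U" "g d > 0" for c d
  proof (rule ccontr)
    assume "\<not> f c * g d \<le> f d * g c"
    then have gt: "f c * g d > f d * g c" by simp
    have gc: "g c \<le> 0" and fd: "f d \<le> 0" using alt[of c] alt[of d] c d by auto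
    \<comment> \<open>Along the segment from \<open>c\<close> to \<open>d\<close>, \<open>f\<close>
      and \<open>g\<close> agree at the parameter \<open>s = (f c - g c) / D\<close>; their common
      value there has the sign of \<open>f c * g d - f d * g c\<close>.\<close>
    define D where "D = f c - g c - f d + g d"
    have D: "D > 0" using c d gc fd by (simp add: D_def)
    define s where "s = (f c - g c) / D"
    have s: "0 \<le> s" "s \<le> 1" using D c d gc fd by (auto simp: s_def D_def)
    have s1: "1 - s = (g d - f d) / D" using D by (simp add: s_def D_def field_simps)
    have "f (mix s c d) = ((g d - f d) * f c + (f c - g c) * f d) / D"
      using f[OF c(1) d(1), of s] unfolding s1 by (simp add: s_def add_divide_distrib)
    also have "\<dots> = (f c * g d - f d * g c) / D" by (simp add: algebra_simps)
    finally have 1: "f (mix s c d) > 0" using gt D by simp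
    have "g (mix s c d) = ((g d - f d) * g c + (f c - g c) * g d) / D"
      using g[OF c(1) d(1), of s] unfolding s1 by (simp add: s_def add_divide_distrib)
    also have "\<dots> = (f c * g d - f d * g c) / D" by (simp add: algebra_simps)
    finally have 2: "g (mix s c d) > 0" using gt D by simp
    show False using alt[OF mix[OF c(1) d(1) s]] 1 2 by simp
  qed
  have L1: "x \<le> 1" if "x \<in> L" for x
    using that alt by (force simp: L_def field_simps)
  then have bdd: "bdd_above L" by (rule bdd_aboveI)
  define t where "t = Sup L"
  have t0: "0 \<le> t" unfolding t_def by (rule cSup_upper[OF _ bdd]) (simp add: L_def)
  have t1: "t \<le> 1" unfolding t_def by (rule cSup_least) (auto simp: L_def intro: L1[unfolded L_def])
  have "(1 - t) * f c + t * g c \<le> 0" if c: "c \<in> U" for c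
  proof -
    consider "f c > 0" | "g c > 0" | "f c \<le> 0" "g c \<le> 0" by linarith
    then show ?thesis
    proof cases
      case 1
      then have gc: "g c \<le> 0" using alt[OF c] by auto
      have "f c / (f c - g c) \<le> t" unfolding t_def
        by (rule cSup_upper[OF _ bdd]) (use 1 c in \<open>auto simp: L_def\<close>)
      then show ?thesis using 1 gc by (simp add: field_simps)
    next
      case 2
      then have fc: "f c \<le> 0" using alt[OF c] by auto
      \<comment> \<open>This is the upper bound that \<open>c\<close> imposes. The element 0 of
        \<open>L\<close> respects it by sign, the others by \<open>cross\<close>.\<close>
      have "t \<le> - f c / (g c - f c)" unfolding t_def
      proof (rule cSup_least)
        show "L \<noteq> {}" by (simp add: L_def)
        fix x assume "x \<in> L"
        then consider "x = 0" | d where "d \<in> U" "f d > 0" "x = f d / (f d - g d)" by (auto simp: L_def)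
        then show "x \<le> - f c / (g c - f c)"
        proof cases
          case 1
          have "0 \<le> - f c / (g c - f c)" by (rule divide_nonneg_nonneg) (use fc 2 in auto)
          then show ?thesis using 1 by simp
        next
          case (2 d)
          have gd: "g d \<le> 0" using alt[OF 2(1)] 2 by auto
          have "f d * (g c - f c) \<le> - f c * (f d - g d)"
            using cross[OF 2(1,2) c \<open>g c > 0\<close>] by (simp add: algebra_simps)
          then show ?thesis unfolding 2(3) using gd fc 2 \<open>g c > 0\<close>
            by (subst pos_divide_le_eq, simp, subst times_divide_eq_left, subst pos_le_divide_eq) auto
        qed
      qed
      then have "t * (g c - f c) \<le> - f c" using 2 fc by (subst (asm) pos_le_divide_eq) auto
      then show ?thesis by (simp add: algebra_simps)
    next
      case 3
      then show ?thesis using t0 t1 by (simp add: add_nonpos_nonpos mult_nonneg_nonpos)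
    qed
  qed
  then show ?thesis using t0 t1 by blast
qed

text \<open>Where the last function is positive, the others satisfy the hypothesis; this part of
  \<open>U\<close> is again convex and yields weights for them by induction. Their combination
  \<open>g\<close> and the last function then form a pair with the alternative on all of
  \<open>U\<close>.\<close>

lemma affine_alternative:
  fixes f :: "nat \<Rightarrow> 'a \<Rightarrow> real"
  assumes "\<And>a b t. a \<in> U \<Longrightarrow> b \<in> U \<Longrightarrow> 0 \<le> t \<Longrightarrow> t \<le> 1 \<Longrightarrow> mix t a b \<in> U"
    and "\<And>i a b t. i \<le> m \<Longrightarrow> a \<in> U \<Longrightarrow> b \<in> U \<Longrightarrow> f i (mix t a b) = (1 - t) * f i a + t * f i b"
    and "\<And>c. c \<in> U \<Longrightarrow> \<exists>i\<le>m. f i c \<le> 0"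
  shows "\<exists>w. (\<forall>i\<le>m. 0 \<le> w i) \<and> (\<Sum>i\<le>m. w i) = 1 \<and> (\<forall>c\<in>U. (\<Sum>i\<le>m. w i * f i c) \<le> 0)"
  using assms
proof (induction m arbitrary: U)
  case 0
  show ?case by (rule exI[of _ "\<lambda>_. 1"]) (use 0(3) in auto)
next
  case (Suc m)
  let ?V = "{c \<in> U. f (Suc m) c > 0}"
  have "\<exists>w. (\<forall>i\<le>m. 0 \<le> w i) \<and> (\<Sum>i\<le>m. w i) = 1 \<and> (\<forall>c\<in>?V. (\<Sum>i\<le>m. w i * f i c) \<le> 0)"
  proof (rule Suc.IH)
    fix a b :: 'a and t :: real assume *: "a \<in> ?V" "b \<in> ?V" "0 \<le> t" "t \<le> 1"
    have "(1 - t) * f (Suc m) a + t * f (Suc m) b > 0"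
    proof (cases "t = 0")
      case False
      then show ?thesis using * by (intro add_nonneg_pos mult_nonneg_nonneg mult_pos_pos) auto
    qed (use * in simp)
    then show "mix t a b \<in> ?V" using * Suc.prems(1)[of a b t] Suc.prems(2)[of "Suc m" a b t] by simp
  next
    fix i a b t assume "i \<le> m" "a \<in> ?V" "b \<in> ?V"
    then show "f i (mix t a b) = (1 - t) * f i a + t * f i b" using Suc.prems(2) by auto
  next
    fix c assume "c \<in> ?V"
    then show "\<exists>i\<le>m. f i c \<le> 0" using Suc.prems(3)[of c] by (auto simp: le_Suc_eq)
  qed
  then obtain w where w: "\<And>i. i \<le> m \<Longrightarrow> 0 \<le> w i" "(\<Sum>i\<le>m. w i) = 1"
    "\<And>c. c \<in> ?V \<Longrightarrow> (\<Sum>i\<le>m. w i * f i c) \<le> 0" by blast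
  define g where "g c = (\<Sum>i\<le>m. w i * f i c)" for c
  have "\<exists>t. 0 \<le> t \<and> t \<le> 1 \<and> (\<forall>c\<in>U. (1 - t) * g c + t * f (Suc m) c \<le> 0)"
  proof (rule affine_pair_alternative[where mix = mix])
    fix a b t assume "a \<in> U" "b \<in> U"
    then show "g (mix t a b) = (1 - t) * g a + t * g b"
      by (simp add: g_def Suc.prems(2) sum_distrib_left sum.distrib sum_subtractf algebra_simps)
    show "f (Suc m) (mix t a b) = (1 - t) * f (Suc m) a + t * f (Suc m) b"
      using Suc.prems(2) \<open>a \<in> U\<close> \<open>b \<in> U\<close> by simp
  next
    fix c assume "c \<in> U"
    then show "g c \<le> 0 \<or> f (Suc m) c \<le> 0" using w(3)[of c] by (force simp: g_def)
  qed (use Suc.prems(1) in auto)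
  then obtain t where t: "0 \<le> t" "t \<le> 1" "\<And>c. c \<in> U \<Longrightarrow> (1 - t) * g c + t * f (Suc m) c \<le> 0" by blast
  define w' where "w' i = (if i = Suc m then t else (1 - t) * w i)" for i
  \<comment> \<open>Used with the constant 1 for the total weight and with the values at a point for
    the inequality.\<close>
  have s: "(\<Sum>i\<le>Suc m. w' i * h i) = (1 - t) * (\<Sum>i\<le>m. w i * h i) + t * h (Suc m)" for h
    by (simp add: w'_def sum_distrib_left mult.assoc)
  show ?case
    apply (rule exI[of _ w'])
    using s[of "\<lambda>_. 1"] s[of "\<lambda>i. f i _"] t w by (auto simp: w'_def g_def)
qed

section \<open>Objective values\<close>

lemma min_cost_le: "x \<in> set xs \<Longrightarrow> min_cost xs c \<le> c \<bullet> x"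
  unfolding min_cost_def by (rule Min_le) auto

lemma min_cost_attained:
  assumes "xs \<noteq> []"
  shows "\<exists>x\<in>set xs. min_cost xs c = c \<bullet> x"
proof -
  have "min_cost xs c \<in> {c \<bullet> x | x. x \<in> set xs}"
    unfolding min_cost_def by (rule Min_in) (use assms in auto)
  then show ?thesis by auto
qed

lemma min_cost_ge: "xs \<noteq> [] \<Longrightarrow> (\<And>x. x \<in> set xs \<Longrightarrow> v \<le> c \<bullet> x) \<Longrightarrow> v \<le> min_cost xs c"
  by (metis min_cost_attained)

lemma objective_cong: "set xs = set ys \<Longrightarrow> objective I xs = objective I ys"
  by (simp add: objective_def min_cost_def)

lemma scalar_prod_convex_sum:
  fixes c :: "real vec"
  assumes "c \<in> carrier_vec n" "set xs \<subseteq> carrier_vec n"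
  shows "c \<bullet> vec n (\<lambda>j. \<Sum>i<length xs. w i * (xs ! i) $ j) = (\<Sum>i<length xs. w i * (c \<bullet> xs ! i))"
proof -
  have dim: "dim_vec (xs ! i) = n" if "i < length xs" for i
    using assms(2) that nth_mem by fastforce
  have "c \<bullet> vec n (\<lambda>j. \<Sum>i<length xs. w i * (xs ! i) $ j)
      = (\<Sum>j = 0..<n. \<Sum>i<length xs. w i * (c $ j * (xs ! i) $ j))"
    by (simp add: scalar_prod_def sum_distrib_left mult.left_commute)
  also have "\<dots> = (\<Sum>i<length xs. \<Sum>j = 0..<n. w i * (c $ j * (xs ! i) $ j))" by (rule sum.swap)
  also have "\<dots> = (\<Sum>i<length xs. w i * (c \<bullet> xs ! i))"
    by (intro sum.cong refl) (simp add: scalar_prod_def sum_distrib_left dim)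
  finally show ?thesis .
qed

text \<open>Replacing the point number j by the last one and forgetting the last one removes a point
  without shifting the others.\<close>

definition drop_nth :: "nat \<Rightarrow> 'a list \<Rightarrow> 'a list" where
  "drop_nth j xs = map (\<lambda>i. if i = j then last xs else xs ! i) [0..<length xs - 1]"

lemma length_drop_nth [simp]: "length (drop_nth j xs) = length xs - 1"
  by (simp add: drop_nth_def)

lemma set_drop_nth_subset: "set (drop_nth j xs) \<subseteq> set xs"
  by (cases "xs = []") (auto simp: drop_nth_def)

lemma nth_in_drop_nth:
  assumes "i < length xs" "i \<noteq> j" "j < length xs"
  shows "xs ! i \<in> set (drop_nth j xs)"
proof (cases "i = length xs - 1")
  case True
  then have "last xs = xs ! i" using assms by (subst last_conv_nth) auto
  then show ?thesis using True assms unfolding drop_nth_def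
    by (auto intro!: image_eqI[of _ _ j])
next
  case False
  then show ?thesis using assms unfolding drop_nth_def by (auto intro!: image_eqI[of _ _ i])
qed

section \<open>One valid instance: duality, removal of a point, optimal values\<close>

locale instance_ctxt =
  fixes I :: m3_inst and n :: nat
  assumes valid: "valid_inst I" and dim: "inst_dim I = n"
begin

lemma feas_carrier: "feas I \<subseteq> carrier_vec n" and unc_carrier: "unc I \<subseteq> carrier_vec n"
  using valid dim by (auto simp: valid_inst_def)

lemma feas_01: "x \<in> feas I \<Longrightarrow> i < n \<Longrightarrow> x $ i = 0 \<or> x $ i = 1"
  and unc_nonneg: "c \<in> unc I \<Longrightarrow> i < n \<Longrightarrow> 0 \<le> c $ i"
  using valid dim by (auto simp: valid_inst_def)

lemma feas_ne: "feas I \<noteq> {}" and unc_ne: "unc I \<noteq> {}"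
  using valid by (auto simp: valid_inst_def)

text \<open>A 0/1 vector is determined by its support. Finiteness is what makes the
  \<open>Min\<close> in \<open>opt\<close> meaningful.\<close>

lemma finite_feas: "finite (feas I)"
proof (rule finite_imageD)
  show "finite ((\<lambda>x. {i. i < n \<and> x $ i = 1}) ` feas I)"
    by (rule finite_subset[of _ "Pow {..<n}"]) auto
  show "inj_on (\<lambda>x. {i. i < n \<and> x $ i = 1}) (feas I)"
  proof (rule inj_onI)
    fix x y assume *: "x \<in> feas I" "y \<in> feas I" "{i. i < n \<and> x $ i = 1} = {i. i < n \<and> y $ i = 1}"
    show "x = y"
    proof (rule eq_vecI)
      have dims: "dim_vec x = n" "dim_vec y = n" using *(1,2) feas_carrier by auto
      then show "dim_vec x = dim_vec y" by simp
      fix i assume "i < dim_vec y"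
      then have "i < n" using dims by simp
      then show "x $ i = y $ i" 
        using *(3)[THEN equalityD1, THEN subsetD, of i] *(3)[THEN equalityD2, THEN subsetD, of i]
          feas_01[OF *(1), of i] feas_01[OF *(2), of i] by auto
    qed
  qed
qed

lemma scalar_nonneg: "c \<in> unc I \<Longrightarrow> x \<in> feas I \<Longrightarrow> 0 \<le> c \<bullet> x"
  using feas_01[of x] unc_nonneg[of c] feas_carrier
  by (fastforce simp: scalar_prod_def intro!: sum_nonneg)

text \<open>The attained maximum bounds the values from above, without which a supremum of reals
  gives no information.\<close>

lemma objective_upper:
  assumes "xs \<noteq> []" "set xs \<subseteq> feas I" "c \<in> unc I"
  shows "min_cost xs c \<le> objective I xs"
proof -
  obtain c0 where "\<forall>c\<in>unc I. min_cost xs c \<le> min_cost xs c0"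
    using valid assms unfolding valid_inst_def attains_max_def by blast
  then show ?thesis unfolding objective_def
    by (intro cSUP_upper assms bdd_aboveI2[of _ _ "min_cost xs c0"]) auto
qed

lemma objective_least: "(\<And>c. c \<in> unc I \<Longrightarrow> min_cost xs c \<le> v) \<Longrightarrow> objective I xs \<le> v"
  unfolding objective_def by (rule cSUP_least[OF unc_ne])

text \<open>Connects the output of linear maximization, whose coefficients stand on the left of the
  scalar product, with \<open>max_cost\<close>, where they stand on the right: a maximiser turns the
  supremum into a computable number.\<close>

lemma max_cost_eqI:
  assumes "a \<in> carrier_vec n" "c \<in> unc I" "\<And>c'. c' \<in> unc I \<Longrightarrow> a \<bullet> c' \<le> a \<bullet> c"
  shows "max_cost I a = c \<bullet> a"
  unfolding max_cost_def
proof (rule cSup_eq_maximum)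
  show "c \<bullet> a \<in> (\<lambda>c. c \<bullet> a) ` unc I" using assms by auto
  fix y assume "y \<in> (\<lambda>c. c \<bullet> a) ` unc I"
  then show "y \<le> c \<bullet> a" using assms unc_carrier
    by (auto simp: comm_scalar_prod[of a n] subset_iff)
qed

lemma max_cost_upper:
  assumes "a \<in> carrier_vec n" "c \<in> unc I"
  shows "c \<bullet> a \<le> max_cost I a"
proof -
  obtain c0 where c0: "c0 \<in> unc I" "\<And>c. c \<in> unc I \<Longrightarrow> a \<bullet> c \<le> a \<bullet> c0"
    using valid assms dim unfolding valid_inst_def attains_max_def by meson
  have "a \<bullet> c \<le> a \<bullet> c0" using c0 assms by auto
  then show ?thesis using max_cost_eqI[OF assms(1) c0] assms unc_carrier c0(1)
    by (auto simp: comm_scalar_prod[of a n] subset_iff)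
qed

lemma max_cost_least: "(\<And>c. c \<in> unc I \<Longrightarrow> c \<bullet> a \<le> v) \<Longrightarrow> max_cost I a \<le> v"
  unfolding max_cost_def by (rule cSUP_least[OF unc_ne])

lemma conv_vecs_carrier: "conv_vecs n xs \<subseteq> carrier_vec n"
  by (auto simp: conv_vecs_def)

text \<open>Weak duality: a minimum is at most any weighted mean.\<close>

lemma objective_le_max_cost:
  assumes "xs \<noteq> []" "set xs \<subseteq> feas I" "y \<in> conv_vecs n xs"
  shows "objective I xs \<le> max_cost I y"
proof (rule objective_least)
  fix c assume c: "c \<in> unc I"
  obtain w where w: "y = vec n (\<lambda>j. \<Sum>i<length xs. w i * (xs ! i) $ j)"
    "\<And>i. i < length xs \<Longrightarrow> 0 \<le> w i" "(\<Sum>i<length xs. w i) = 1"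
    using assms(3) unfolding conv_vecs_def by blast
  have "min_cost xs c = (\<Sum>i<length xs. w i * min_cost xs c)"
    using w(3) by (simp flip: sum_distrib_right)
  also have "\<dots> \<le> (\<Sum>i<length xs. w i * (c \<bullet> xs ! i))"
    by (intro sum_mono mult_left_mono min_cost_le) (use w in auto)
  also have "\<dots> = c \<bullet> y" unfolding w(1)
    by (rule scalar_prod_convex_sum[symmetric]) (use c unc_carrier feas_carrier assms in auto)
  also have "\<dots> \<le> max_cost I y"
    using max_cost_upper[OF _ c] conv_vecs_carrier assms(3) by auto
  finally show "min_cost xs c \<le> max_cost I y" .
qed

text \<open>Strong duality. At each \<open>c\<close> some
  \<open>c \<bullet> xs ! i - objective I xs\<close> is non-positive, and these functions are affine
  in \<open>c\<close>, so the theorem of the alternative supplies weights independent of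
  \<open>c\<close>.\<close>

lemma ex_weights:
  assumes "xs \<noteq> []" "set xs \<subseteq> feas I"
  shows "\<exists>w. (\<forall>i<length xs. 0 \<le> w i) \<and> (\<Sum>i<length xs. w i) = 1
     \<and> (\<forall>c\<in>unc I. (\<Sum>i<length xs. w i * (c \<bullet> xs ! i)) \<le> objective I xs)"
proof -
  \<comment> \<open>The alternative is stated for indices up to and including \<open>m\<close>,
    hence the last index.\<close>
  define m where "m = length xs - 1"
  have m: "{..<length xs} = {..m}" and m': "i < length xs \<longleftrightarrow> i \<le> m" for i
    using assms(1) by (auto simp: m_def) (cases xs; simp; linarith)+
  let ?mix = "\<lambda>t a b. (1 - t) \<cdot>\<^sub>v a + t \<cdot>\<^sub>v b :: real vec"
  have "\<exists>w. (\<forall>i\<le>m. 0 \<le> w i) \<and> (\<Sum>i\<le>m. w i) = 1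
     \<and> (\<forall>c\<in>unc I. (\<Sum>i\<le>m. w i * (c \<bullet> xs ! i - objective I xs)) \<le> 0)"
  proof (rule affine_alternative[where mix = ?mix])
    fix a b :: "real vec" and t :: real assume "a \<in> unc I" "b \<in> unc I" "0 \<le> t" "t \<le> 1"
    then show "?mix t a b \<in> unc I" using valid by (auto simp: valid_inst_def convex_vec_def)
  next
    fix i a b t assume *: "i \<le> m" "a \<in> unc I" "b \<in> unc I"
    have "xs ! i \<in> carrier_vec n" using * m' assms(2) feas_carrier nth_mem by blast
    moreover have "a \<in> carrier_vec n" "b \<in> carrier_vec n" using * unc_carrier by auto
    ultimately have "?mix t a b \<bullet> xs ! i = (1 - t) * (a \<bullet> xs ! i) + t * (b \<bullet> xs ! i)"
      by (subst add_scalar_prod_distrib[of _ n]) (auto simp: smult_scalar_prod_distrib)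
    then show "?mix t a b \<bullet> xs ! i - objective I xs
       = (1 - t) * (a \<bullet> xs ! i - objective I xs) + t * (b \<bullet> xs ! i - objective I xs)"
      by (simp add: algebra_simps)
  next
    fix c assume c: "c \<in> unc I"
    obtain x where "x \<in> set xs" "min_cost xs c = c \<bullet> x" using min_cost_attained assms(1) by blast
    then show "\<exists>i\<le>m. c \<bullet> xs ! i - objective I xs \<le> 0"
      using objective_upper[OF assms c] by (auto simp: in_set_conv_nth m')
  qed
  then obtain w where w: "\<And>i. i \<le> m \<Longrightarrow> 0 \<le> w i" "(\<Sum>i\<le>m. w i) = 1"
     "\<And>c. c \<in> unc I \<Longrightarrow> (\<Sum>i\<le>m. w i * (c \<bullet> xs ! i - objective I xs)) \<le> 0" by blast
  show ?thesis
  proof (intro exI[of _ w] conjI allI impI ballI)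
    fix c assume "c \<in> unc I"
    from w(3)[OF this] show "(\<Sum>i<length xs. w i * (c \<bullet> xs ! i)) \<le> objective I xs"
      unfolding m using w(2) by (simp add: right_diff_distrib sum_subtractf flip: sum_distrib_right)
  qed (use w m m' in auto)
qed

text \<open>The point built from the weights of \<open>ex_weights\<close> competes with
  \<open>x\<close>; weak duality gives the other inequality. Thus a solution of the convex problem
  reveals the objective value.\<close>

lemma max_cost_minimiser:
  assumes xs: "xs \<noteq> []" "set xs \<subseteq> feas I"
    and x: "x \<in> conv_vecs n xs" "\<And>y. y \<in> conv_vecs n xs \<Longrightarrow> max_cost I x \<le> max_cost I y"
  shows "max_cost I x = objective I xs"
proof (rule antisym)
  obtain w where w: "\<And>i. i < length xs \<Longrightarrow> 0 \<le> w i" "(\<Sum>i<length xs. w i) = 1"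
    "\<And>c. c \<in> unc I \<Longrightarrow> (\<Sum>i<length xs. w i * (c \<bullet> xs ! i)) \<le> objective I xs"
    using ex_weights[OF xs] by blast
  let ?y = "vec n (\<lambda>j. \<Sum>i<length xs. w i * (xs ! i) $ j)"
  have "?y \<in> conv_vecs n xs" using w by (auto simp: conv_vecs_def)
  then have "max_cost I x \<le> max_cost I ?y" by (rule x(2))
  also have "\<dots> \<le> objective I xs"
  proof (rule max_cost_least)
    fix c assume c: "c \<in> unc I"
    then show "c \<bullet> ?y \<le> objective I xs"
      by (subst scalar_prod_convex_sum) (use c w unc_carrier feas_carrier xs in auto)
  qed
  finally show "max_cost I x \<le> objective I xs" .
qed (rule objective_le_max_cost[OF xs x(1)])

text \<open>Only the nonzero entries of \<open>x\<close>, all equal to 1, contribute, each at most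
  the maximum norm of \<open>c\<close>.\<close>

lemma cost_le:
  assumes c: "c \<in> unc I" and x: "x \<in> feas I" and M: "norm_inf c \<le> M"
  shows "c \<bullet> x \<le> M * real (norm0 x)"
proof -
  have dims: "dim_vec c = n" "dim_vec x = n" using c x unc_carrier feas_carrier by auto
  have "c $ i \<le> M" if "i < n" for i
  proof -
    have "\<bar>c $ i\<bar> \<le> norm_inf c" unfolding norm_inf_def
      by (rule Max_ge) (use that dims in auto)
    then show ?thesis using M by simp
  qed
  then have "c \<bullet> x \<le> (\<Sum>i = 0..<n. if x $ i \<noteq> 0 then M else 0)"
    unfolding scalar_prod_def dims using feas_01[OF x] by (intro sum_mono) fastforce
  also have "\<dots> = M * real (norm0 x)"
    by (simp add: norm0_def dims sum.If_cases Int_def conj_commute)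
  finally show ?thesis .
qed

text \<open>Some point has weight at most 1 / length xs in an optimal convex combination; after its removal
  at most this fraction of the cost of a single point is lost.\<close>

lemma ex_drop_nth:
  assumes xs: "2 \<le> length xs" "set xs \<subseteq> feas I" and M: "0 \<le> M" "\<And>c. c \<in> unc I \<Longrightarrow> norm_inf c \<le> M"
    and p: "\<And>x. x \<in> feas I \<Longrightarrow> real (norm0 x) \<le> p"
  shows "\<exists>j<length xs. objective I (drop_nth j xs) \<le> objective I xs + M * p / real (length xs)"
proof -
  define r where "r = length xs"
  have xs0: "xs \<noteq> []" using xs by auto
  obtain w where w: "\<And>i. i < r \<Longrightarrow> 0 \<le> w i" "(\<Sum>i<r. w i) = 1"
    "\<And>c. c \<in> unc I \<Longrightarrow> (\<Sum>i<r. w i * (c \<bullet> xs ! i)) \<le> objective I xs"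
    using ex_weights[OF xs0 xs(2)] unfolding r_def by blast
  have r: "r \<ge> 2" using xs by (simp add: r_def)
  \<comment> \<open>Otherwise every weight would exceed the mean weight.\<close>
  have "\<exists>j<r. w j \<le> 1 / r"
  proof (rule ccontr)
    assume "\<not> ?thesis"
    then have "(\<Sum>i<r. 1 / real r) < (\<Sum>i<r. w i)"
      by (intro sum_strict_mono) (use r in \<open>auto simp: not_le lessThan_empty_iff\<close>)
    then show False using r w(2) by simp
  qed
  then obtain j where j: "j < r" "w j \<le> 1 / r" by blast
  define ys where "ys = drop_nth j xs"
  \<comment> \<open>Starting from at least two points leaves one, so \<open>min_cost ys\<close> is a
    minimum over a nonempty set.\<close>
  have "length ys \<noteq> 0" using r by (simp add: ys_def r_def)
  then have ys: "ys \<noteq> []" "set ys \<subseteq> set xs"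
    using set_drop_nth_subset[of j xs] unfolding ys_def by fastforce+
  have p0: "0 \<le> p" using p feas_ne by (metis all_not_in_conv of_nat_0_le_iff order_trans)
  have "objective I ys \<le> objective I xs + M * p / r"
  proof (rule objective_least)
    fix c assume c: "c \<in> unc I"
    let ?m = "min_cost ys c"
    have m0: "0 \<le> ?m" using ys xs(2) scalar_nonneg[OF c] by (intro min_cost_ge) auto
    obtain y where y: "y \<in> set ys" using ys(1) by (cases ys) auto
    have "?m \<le> c \<bullet> y" by (rule min_cost_le[OF y])
    also have "\<dots> \<le> M * real (norm0 y)" by (rule cost_le[OF c _ M(2)[OF c]]) (use y ys xs in auto)
    also have "\<dots> \<le> M * p" using p[of y] y ys xs M(1) by (intro mult_left_mono) auto
    finally have mp: "?m \<le> M * p" .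
    \<comment> \<open>The points other than number \<open>j\<close> survive in \<open>ys\<close> and
      cost at least \<open>?m\<close> each; their weights sum to \<open>1 - w j\<close>.\<close>
    have "?m - w j * ?m = (\<Sum>i\<in>{..<r} - {j}. w i * ?m)"
      using w(2) j(1) by (simp add: sum_diff1 left_diff_distrib flip: sum_distrib_right)
    also have "\<dots> \<le> (\<Sum>i\<in>{..<r} - {j}. w i * (c \<bullet> xs ! i))"
      using w(1) j(1) nth_in_drop_nth[of _ xs j] unfolding ys_def r_def
      by (intro sum_mono mult_left_mono min_cost_le) auto
    \<comment> \<open>The removed term may return to the sum because costs are non-negative.\<close>
    also have "\<dots> \<le> (\<Sum>i<r. w i * (c \<bullet> xs ! i))"
      using w(1) scalar_nonneg[OF c] xs(2) j(1) unfolding r_def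
      by (intro sum_mono2) (auto intro!: mult_nonneg_nonneg simp: subset_iff)
    also have "\<dots> \<le> objective I xs" by (rule w(3)[OF c])
    finally have "?m \<le> objective I xs + w j * ?m" by simp
    also have "w j * ?m \<le> 1 / r * (M * p)" by (rule mult_mono) (use j mp m0 in auto)
    finally show "?m \<le> objective I xs + M * p / r" by simp
  qed
  then show ?thesis using j(1) unfolding ys_def r_def by blast
qed

lemma finite_solutions: "finite (solutions I k)"
  using finite_lists_length_eq[OF finite_feas, of k] by (simp add: solutions_def conj_commute)

lemma solutions_ne: "solutions I k \<noteq> {}"
proof -
  obtain x where "x \<in> feas I" using feas_ne by auto
  then have "replicate k x \<in> solutions I k" by (auto simp: solutions_def)
  then show ?thesis by auto
qed

lemma opt_attained: "\<exists>xs\<in>solutions I k. objective I xs = opt I k"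
  using Min_in[of "objective I ` solutions I k"] finite_solutions solutions_ne
  unfolding opt_def by fastforce

lemma opt_le: "xs \<in> solutions I k \<Longrightarrow> opt I k \<le> objective I xs"
  unfolding opt_def using finite_solutions by simp

text \<open>Padding a solution with copies of its first point changes its length but not its set of
  points, hence not its value.\<close>

lemma opt_antimono:
  assumes "1 \<le> k" "k \<le> k'"
  shows "opt I k' \<le> opt I k"
proof -
  obtain xs where xs: "xs \<in> solutions I k" "objective I xs = opt I k" using opt_attained by blast
  let ?ys = "replicate (k' - k) (hd xs) @ xs"
  have "xs \<noteq> []" using xs(1) assms by (auto simp: solutions_def)
  then have "set ?ys = set xs" by (auto simp: set_replicate_conv_if)
  moreover from this have "?ys \<in> solutions I k'" using xs(1) assms by (auto simp: solutions_def)
  ultimately show ?thesis using opt_le[of ?ys k'] xs(2) objective_cong[of ?ys xs] by simp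
qed

text \<open>Each coordinate in which another 0/1 vector differs from \<open>x\<close> raises the
  cost by exactly 1. So \<open>x\<close> is the unique minimiser, and no tie-breaking of the oracle
  can interfere.\<close>

lemma oracle_sign_vector:
  assumes "valid_oracle I \<O>" "x \<in> feas I" "c \<in> carrier_vec n"
    and c: "\<And>i. i < n \<Longrightarrow> c $ i = (if x $ i = 1 then - 1 else 1)"
  shows "\<O> c = x"
proof -
  let ?y = "\<O> c"
  have y: "?y \<in> feas I" "c \<bullet> ?y \<le> c \<bullet> x" using assms by (auto simp: valid_oracle_def dim)
  have dims: "dim_vec ?y = n" "dim_vec x = n" using y assms feas_carrier by auto
  have nonneg: "0 \<le> c $ i * (?y $ i - x $ i)" if "i < n" for i
    using feas_01[OF y(1) that] feas_01[OF assms(2) that] c[OF that] by auto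
  have "(\<Sum>i = 0..<n. c $ i * (?y $ i - x $ i)) = c \<bullet> ?y - c \<bullet> x"
    by (simp add: scalar_prod_def dims right_diff_distrib sum_subtractf)
  then have "(\<Sum>i = 0..<n. c $ i * (?y $ i - x $ i)) = 0"
    using y(2) nonneg by (intro antisym sum_nonneg) auto
  then have "\<forall>i\<in>{0..<n}. c $ i * (?y $ i - x $ i) = 0"
    using nonneg by (subst (asm) sum_nonneg_eq_0_iff) auto
  then have *: "c $ i * (?y $ i - x $ i) = 0" if "i < n" for i using that by simp
  have "?y $ i = x $ i" if "i < n" for i
    using c[OF that] *[OF that] by (simp split: if_splits)
  then show ?thesis using dims by (intro eq_vecI) auto
qed

end

section \<open>Reasoning about running times\<close>

text \<open>Upper bounds in place of exact step counts, so that times can be rounded up after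
  programs are composed; the final store remains exact.\<close>

definition reach :: "nat \<Rightarrow> real list \<Rightarrow> (real vec \<Rightarrow> real vec) \<Rightarrow> com \<Rightarrow> store \<Rightarrow> nat \<Rightarrow> store \<Rightarrow> bool" where
  "reach n d \<O> P s T s' \<longleftrightarrow> (\<exists>t\<le>T. exec n d \<O> P s t s')"

lemma reach_mono: "reach n d \<O> P s T s' \<Longrightarrow> T \<le> T' \<Longrightarrow> reach n d \<O> P s T' s'"
  unfolding reach_def using order_trans by blast

lemma reach_Skip: "reach n d \<O> Skip s 1 s"
  unfolding reach_def using exec.Skip by blast

lemma reach_NAssign: "reach n d \<O> (NAssign v e) s 1 (set_nreg v (nval e s) s)"
  unfolding reach_def using exec.NAssign by blast

lemma reach_RAssign: "reach n d \<O> (RAssign a e f) s 1 (set_cell a (nval e s) (rval d f s) s)"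
  unfolding reach_def using exec.RAssign by blast

lemma reach_Oracle: "reach n d \<O> (Oracle a b) s 1 (store_vec n b (\<O> (row_at n s a 0)) s)"
  unfolding reach_def using exec.Oracle by blast

lemma reach_Seq:
  "reach n d \<O> P s T s' \<Longrightarrow> reach n d \<O> Q s' T' s'' \<Longrightarrow> reach n d \<O> (Seq P Q) s (T + T') s''"
  unfolding reach_def using exec.Seq add_mono by blast

lemma reach_CondTrue:
  "bval d b s \<Longrightarrow> reach n d \<O> P s T s' \<Longrightarrow> reach n d \<O> (Cond b P Q) s (Suc T) s'"
  unfolding reach_def using exec.CondTrue Suc_le_mono by blast

lemma reach_CondFalse:
  "\<not> bval d b s \<Longrightarrow> reach n d \<O> Q s T s' \<Longrightarrow> reach n d \<O> (Cond b P Q) s (Suc T) s'"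
  unfolding reach_def using exec.CondFalse Suc_le_mono by blast

lemma reach_WhileFalse: "\<not> bval d b s \<Longrightarrow> reach n d \<O> (While b P) s 1 s"
  unfolding reach_def using exec.WhileFalse by blast

lemma reach_WhileTrue:
  assumes "bval d b s" "reach n d \<O> P s T s'" "reach n d \<O> (While b P) s' T' s''"
  shows "reach n d \<O> (While b P) s (Suc (T + T')) s''"
  using assms exec.WhileTrue unfolding reach_def by (metis Suc_le_mono add_mono)

lemma nreg_set_nreg [simp]: "nreg (set_nreg v x s) = (nreg s)(v := x)"
  and arr_set_nreg [simp]: "arr (set_nreg v x s) = arr s"
  by (simp_all add: set_nreg_def)

lemma nreg_set_cell [simp]: "nreg (set_cell a i y s) = nreg s"
  and arr_set_cell [simp]: "arr (set_cell a i y s) = (arr s)(a := (arr s a)(i := y))"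
  by (simp_all add: set_cell_def)

lemma nreg_store_vec [simp]: "nreg (store_vec n a x s) = nreg s"
  and arr_store_vec [simp]:
    "arr (store_vec n a x s) = (arr s)(a := (\<lambda>i. if i < n then x $ i else arr s a i))"
  by (simp_all add: store_vec_def)

section \<open>Footprints: what a program can write\<close>

primrec wregs :: "com \<Rightarrow> nat set" where
  "wregs Skip = {}"
| "wregs (NAssign v e) = {v}"
| "wregs (RAssign a e f) = {}"
| "wregs (Oracle a b) = {}"
| "wregs (Seq P Q) = wregs P \<union> wregs Q"
| "wregs (Cond b P Q) = wregs P \<union> wregs Q"
| "wregs (While b P) = wregs P"

primrec warrs :: "com \<Rightarrow> nat set" where
  "warrs Skip = {}"
| "warrs (NAssign v e) = {}"
| "warrs (RAssign a e f) = {a}"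
| "warrs (Oracle a b) = {b}"
| "warrs (Seq P Q) = warrs P \<union> warrs Q"
| "warrs (Cond b P Q) = warrs P \<union> warrs Q"
| "warrs (While b P) = warrs P"

text \<open>A program text is finite, so some registers and arrays are never written by the given
  subprograms. What these read beyond their inputs does no harm, since their specifications hold for
  arbitrary contents of the remaining memory.\<close>

lemma finite_wregs: "finite (wregs P)" and finite_warrs: "finite (warrs P)"
  by (induction P) auto

lemma exec_frame:
  "exec n d \<O> P s t s' \<Longrightarrow> (\<forall>v. v \<notin> wregs P \<longrightarrow> nreg s' v = nreg s v) \<and> (\<forall>a. a \<notin> warrs P \<longrightarrow> arr s' a = arr s a)"
  by (induction rule: exec.induct) auto

lemma reach_nreg: "reach n d \<O> P s T s' \<Longrightarrow> v \<notin> wregs P \<Longrightarrow> nreg s' v = nreg s v"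
  and reach_arr: "reach n d \<O> P s T s' \<Longrightarrow> a \<notin> warrs P \<Longrightarrow> arr s' a = arr s a"
  unfolding reach_def using exec_frame by blast+

section \<open>Unrolled sequences, counting loops and copying of cells\<close>

primrec seq_list :: "com list \<Rightarrow> com" where
  "seq_list [] = Skip"
| "seq_list (P # Ps) = Seq P (seq_list Ps)"

lemma wregs_seq_list [simp]: "wregs (seq_list Ps) = (\<Union>P\<in>set Ps. wregs P)"
  and warrs_seq_list [simp]: "warrs (seq_list Ps) = (\<Union>P\<in>set Ps. warrs P)"
  by (induction Ps) auto

text \<open>\<open>Inv i\<close> holds before command number \<open>i\<close>, so the commands may
  differ. The number of commands is part of the text, which suits repetitions governed by the fixed
  parameters.\<close>

lemma reach_seq_list:
  assumes "Inv 0 s"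
    and "\<And>i s. i < length Ps \<Longrightarrow> Inv i s \<Longrightarrow> \<exists>s'. reach n d \<O> (Ps ! i) s T s' \<and> Inv (Suc i) s'"
  shows "\<exists>s'. reach n d \<O> (seq_list Ps) s (1 + length Ps * T) s' \<and> Inv (length Ps) s'"
  using assms
proof (induction Ps arbitrary: s Inv)
  case Nil
  then show ?case using reach_Skip by (auto intro: exI[of _ s])
next
  case (Cons P Ps)
  obtain s1 where s1: "reach n d \<O> P s T s1" "Inv (Suc 0) s1"
    using Cons.prems(2)[of 0 s] Cons.prems(1) by auto
  have "\<exists>s'. reach n d \<O> (seq_list Ps) s1 (1 + length Ps * T) s' \<and> Inv (Suc (length Ps)) s'"
  proof (rule Cons.IH[where Inv = "\<lambda>i. Inv (Suc i)"])
    fix i s assume "i < length Ps" "Inv (Suc i) s"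
    then show "\<exists>s'. reach n d \<O> (Ps ! i) s T s' \<and> Inv (Suc (Suc i)) s'"
      using Cons.prems(2)[of "Suc i" s] by auto
  qed (rule s1(2))
  then obtain s2 where s2: "reach n d \<O> (seq_list Ps) s1 (1 + length Ps * T) s2" "Inv (Suc (length Ps)) s2"
    by blast
  have "reach n d \<O> (seq_list (P # Ps)) s (1 + length (P # Ps) * T) s2"
    unfolding seq_list.simps by (rule reach_mono[OF reach_Seq[OF s1(1) s2(1)]]) simp
  then show ?case using s2(2) by auto
qed

definition for_loop :: "nat \<Rightarrow> nexp \<Rightarrow> com \<Rightarrow> com" where
  "for_loop i e P = Seq (NAssign i (NConst 0))
     (While (NLess (NReg i) e) (Seq P (NAssign i (NAdd (NReg i) (NConst 1)))))"

lemma wregs_for_loop [simp]: "wregs (for_loop i e P) = insert i (wregs P)"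
  and warrs_for_loop [simp]: "warrs (for_loop i e P) = warrs P"
  by (auto simp: for_loop_def)

text \<open>The limit \<open>e\<close> is evaluated anew at each test, so \<open>bound\<close> is
  required throughout. A pass costs \<open>T\<close> plus one test and one increment; the constant 2
  pays for the initial assignment and the last, failing test.\<close>

lemma reach_for_loop:
  assumes start: "Inv 0 (set_nreg i 0 s)"
    and step: "\<And>j s. j < m \<Longrightarrow> Inv j s \<Longrightarrow> nreg s i = j \<Longrightarrow>
      \<exists>s'. reach n d \<O> P s T s' \<and> nreg s' i = j \<and> Inv (Suc j) (set_nreg i (Suc j) s')"
    and bound: "\<And>j s. j \<le> m \<Longrightarrow> Inv j s \<Longrightarrow> nreg s i = j \<Longrightarrow> nval e s = m"
  shows "\<exists>s'. reach n d \<O> (for_loop i e P) s (2 + m * (T + 2)) s' \<and> Inv m s'"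
proof -
  let ?W = "While (NLess (NReg i) e) (Seq P (NAssign i (NAdd (NReg i) (NConst 1))))"
  have "\<exists>s'. reach n d \<O> ?W s (1 + (m - j) * (T + 2)) s' \<and> Inv m s'"
    if "j \<le> m" "Inv j s" "nreg s i = j" for j s
    using that
  proof (induction "m - j" arbitrary: j s)
    case 0
    have "\<not> bval d (NLess (NReg i) e) s" using bound[OF 0(2-4)] 0 by simp
    then have "reach n d \<O> ?W s 1 s" by (rule reach_WhileFalse)
    then show ?case using 0 by (auto intro!: exI[of _ s])
  next
    case (Suc k)
    have b: "bval d (NLess (NReg i) e) s" using bound[OF Suc(3-5)] Suc by simp
    have "j < m" using Suc(2) by simp
    then obtain s1 where s1: "reach n d \<O> P s T s1" "nreg s1 i = j" "Inv (Suc j) (set_nreg i (Suc j) s1)"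
      using step[OF _ Suc(4,5)] by blast
    have 2: "reach n d \<O> (NAssign i (NAdd (NReg i) (NConst 1))) s1 1 (set_nreg i (Suc j) s1)"
      using reach_NAssign[of n d \<O> i "NAdd (NReg i) (NConst 1)" s1] s1(2) by simp
    obtain s2 where s2: "reach n d \<O> ?W (set_nreg i (Suc j) s1) (1 + (m - Suc j) * (T + 2)) s2" "Inv m s2"
      using Suc(1)[OF _ _ s1(3)] Suc(2) \<open>j < m\<close>
      by (metis Suc_leI diff_Suc_Suc Suc_diff_Suc fun_upd_same nat.inject nreg_set_nreg)
    have mj: "m - j = Suc (m - Suc j)" using Suc(2) by simp
    have "reach n d \<O> ?W s (1 + (m - j) * (T + 2)) s2"
      by (rule reach_mono[OF reach_WhileTrue[OF b reach_Seq[OF s1(1) 2] s2(1)]]) (simp add: mj)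
    then show ?case using s2(2) by blast
  qed
  from this[of 0 "set_nreg i 0 s"] start obtain s'
    where s': "reach n d \<O> ?W (set_nreg i 0 s) (1 + m * (T + 2)) s'" "Inv m s'" by auto
  have "reach n d \<O> (for_loop i e P) s (2 + m * (T + 2)) s'"
    unfolding for_loop_def
    by (rule reach_mono[OF reach_Seq[OF reach_NAssign]]) (use s'(1) in auto)
  then show ?thesis using s'(2) by blast
qed

text \<open>\<open>copy_cells i b eb a ea e\<close> copies e cells of array a, from cell ea on, to array b, from cell eb on.\<close>

definition copy_cells :: "nat \<Rightarrow> nat \<Rightarrow> nexp \<Rightarrow> nat \<Rightarrow> nexp \<Rightarrow> nexp \<Rightarrow> com" where
  "copy_cells i b eb a ea e = for_loop i e (RAssign b (NAdd eb (NReg i)) (RCell a (NAdd ea (NReg i))))"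

lemma wregs_copy_cells [simp]: "wregs (copy_cells i b eb a ea e) = {i}"
  and warrs_copy_cells [simp]: "warrs (copy_cells i b eb a ea e) = {b}"
  by (auto simp: copy_cells_def)

text \<open>By \<open>ev\<close>, offsets and length may depend on every register but the counter
  and thus stay constant during the loop; \<open>a \<noteq> b\<close> protects the source. The last
  conjunct serves the replacement of a single row.\<close>

lemma reach_copy_cells:
  fixes s :: store
  assumes "a \<noteq> b"
    and ev: "\<And>s' :: store. (\<And>v. v \<noteq> i \<Longrightarrow> nreg s' v = nreg s v) \<Longrightarrow> nval eb s' = ob \<and> nval ea s' = oa \<and> nval e s' = m"
  shows "\<exists>s'. reach n d \<O> (copy_cells i b eb a ea e) s (2 + m * 3) s'
     \<and> (\<forall>x<m. arr s' b (ob + x) = arr s a (oa + x))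
     \<and> (\<forall>x. \<not> (ob \<le> x \<and> x < ob + m) \<longrightarrow> arr s' b x = arr s b x)"
proof -
  let ?Inv = "\<lambda>j (s' :: store). (\<forall>v. v \<noteq> i \<longrightarrow> nreg s' v = nreg s v) \<and> arr s' a = arr s a
     \<and> (\<forall>x<j. arr s' b (ob + x) = arr s a (oa + x))
     \<and> (\<forall>x. \<not> (ob \<le> x \<and> x < ob + j) \<longrightarrow> arr s' b x = arr s b x)"
  have "\<exists>s'. reach n d \<O> (copy_cells i b eb a ea e) s (2 + m * (1 + 2)) s' \<and> ?Inv m s'"
    unfolding copy_cells_def
  proof (rule reach_for_loop[where Inv = ?Inv])
    fix j s' assume inv: "?Inv j s'" and j: "j < m" "nreg s' i = j"
    have vals: "nval eb s' = ob" "nval ea s' = oa" using ev[of s'] inv by auto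
    let ?s = "set_cell b (ob + j) (arr s' a (oa + j)) s'"
    have "reach n d \<O> (RAssign b (NAdd eb (NReg i)) (RCell a (NAdd ea (NReg i)))) s' 1 ?s"
      using reach_RAssign[of n d \<O> b "NAdd eb (NReg i)" "RCell a (NAdd ea (NReg i))" s'] j vals by simp
    moreover have "?Inv (Suc j) (set_nreg i (Suc j) ?s)"
      using inv assms(1) by (auto simp: less_Suc_eq)
    ultimately show "\<exists>s''. reach n d \<O> (RAssign b (NAdd eb (NReg i)) (RCell a (NAdd ea (NReg i)))) s' 1 s''
        \<and> nreg s'' i = j \<and> ?Inv (Suc j) (set_nreg i (Suc j) s'')"
      using j by (intro exI[of _ ?s]) auto
  next
    fix j s' assume "?Inv j s'"
    then show "nval e s' = m" using ev[of s'] by auto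
  qed auto
  then show ?thesis by (auto simp: numeral_3_eq_3)
qed

lemma cell_less: "i < r \<Longrightarrow> j < n \<Longrightarrow> i * n + j < r * (n::nat)"
proof -
  assume "i < r" "j < n"
  then have "i * n + j < Suc i * n" by simp
  also have "\<dots> \<le> r * n" using \<open>i < r\<close> by (intro mult_le_mono1) simp
  finally show ?thesis .
qed

text \<open>Integer division of a cell number by \<open>n\<close> recovers the row number.\<close>

lemma cell_neq: "i \<noteq> k \<Longrightarrow> j < n \<Longrightarrow> \<not> (k * n \<le> i * n + j \<and> i * n + j < k * n + (n::nat))"
proof -
  assume *: "i \<noteq> k" "j < n"
  then have "(i * n + j) div n = i" by simp
  moreover have "x div n = k" if "k * n \<le> x" "x < k * n + n" for x
    using that * by (intro div_nat_eqI) (auto simp: mult.commute)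
  ultimately show ?thesis using * by metis
qed

lemma row_at_cong: "(\<And>j. j < n \<Longrightarrow> arr s a (i * n + j) = arr s' a' (i' * n + j)) \<Longrightarrow> row_at n s a i = row_at n s' a' i'"
  by (auto simp: row_at_def)

lemma rows_at_cong:
  assumes "\<And>x. x < r * n \<Longrightarrow> arr s a x = arr s' a' x"
  shows "rows_at n s a r = rows_at n s' a' r"
  unfolding rows_at_def using assms by (auto intro!: row_at_cong simp: cell_less)

lemma length_rows_at [simp]: "length (rows_at n s a r) = r"
  by (simp add: rows_at_def)

lemma nth_rows_at [simp]: "i < r \<Longrightarrow> rows_at n s a r ! i = row_at n s a i"
  by (simp add: rows_at_def)

section \<open>The algorithm\<close>

notation Seq (infixr ";;" 60)

text \<open>The programs below use registers and arrays with numbers from B on, which the given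
  subprograms do not touch. Register B holds the dimension n and register B + 1 the current number r
  of points; array B holds the r points to be evaluated, array B + 1 the points kept by the greedy
  algorithm, and array B + 2 the best r points so far. Cells 0 and 1 of array B + 4 hold the last and
  the best objective value, and register B + 2 tells whether there is a best value.\<close>

definition evaluate :: "nat \<Rightarrow> com \<Rightarrow> com \<Rightarrow> com" where
  "evaluate B PC PL =
     copy_cells (B+3) 0 (NConst 0) B (NConst 0) (NMul (NReg (B+1)) (NReg B)) ;;
     NAssign 0 (NReg B) ;; NAssign 1 (NReg (B+1)) ;; PC ;;
     copy_cells (B+3) (B+3) (NConst 0) 1 (NConst 0) (NReg B) ;;
     copy_cells (B+3) 0 (NConst 0) 1 (NConst 0) (NReg B) ;;
     NAssign 0 (NReg B) ;; PL ;;
     RAssign (B+4) (NConst 0) (RNat (NConst 0)) ;;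
     for_loop (B+3) (NReg B) (RAssign (B+4) (NConst 0)
       (RAdd (RCell (B+4) (NConst 0)) (RMul (RCell 1 (NReg (B+3))) (RCell (B+3) (NReg (B+3))))))"

text \<open>Copying \<open>r * n\<close> cells is charged as \<open>n * n\<close>, so that the bound
  depends on the dimension and not on the current number of points.\<close>

definition eval_time :: "nat \<Rightarrow> nat \<Rightarrow> nat \<Rightarrow> nat" where
  "eval_time TC TL n = 12 + 3 * (n * n) + 9 * n + TC + TL"

text \<open>Memory is uninitialised and there is no infinite value to start from, hence a flag is
  tested together with the comparison.\<close>

definition trial :: "nat \<Rightarrow> com \<Rightarrow> com \<Rightarrow> com" where
  "trial B PC PL = evaluate B PC PL ;;
     Cond (BAnd (NLess (NConst 0) (NReg (B+2))) (BNot (RLess (RCell (B+4) (NConst 0)) (RCell (B+4) (NConst 1)))))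
       Skip
       (RAssign (B+4) (NConst 1) (RCell (B+4) (NConst 0)) ;; NAssign (B+2) (NConst 1) ;;
        copy_cells (B+3) (B+2) (NConst 0) B (NConst 0) (NMul (NReg (B+1)) (NReg B)))"

definition trial_time :: "nat \<Rightarrow> nat \<Rightarrow> nat \<Rightarrow> nat" where
  "trial_time TC TL n = eval_time TC TL n + 5 + 3 * (n * n)"

text \<open>With \<open>r\<close> already decreased, rows 0 to \<open>r - 1\<close> are copied, and
  row \<open>r\<close>, the last point, is put over row \<open>j\<close>. For \<open>j = r\<close>
  it lands outside the \<open>r\<close> evaluated rows, so that the last point itself is left
  out.\<close>

definition greedy_step :: "nat \<Rightarrow> com \<Rightarrow> com \<Rightarrow> com" where
  "greedy_step B PC PL = NAssign (B+1) (NSub (NReg (B+1)) (NConst 1)) ;; NAssign (B+2) (NConst 0) ;;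
     for_loop (B+4) (NAdd (NReg (B+1)) (NConst 1))
       (copy_cells (B+3) B (NConst 0) (B+1) (NConst 0) (NMul (NReg (B+1)) (NReg B)) ;;
        copy_cells (B+3) B (NMul (NReg (B+4)) (NReg B)) (B+1) (NMul (NReg (B+1)) (NReg B)) (NReg B) ;;
        trial B PC PL) ;;
     copy_cells (B+3) (B+1) (NConst 0) (B+2) (NConst 0) (NMul (NReg (B+1)) (NReg B))"

definition greedy_time :: "nat \<Rightarrow> nat \<Rightarrow> nat \<Rightarrow> nat" where
  "greedy_time TC TL n = 6 + 3 * (n * n) + n * (6 + 3 * (n * n) + 3 * n + trial_time TC TL n)"

definition large_case :: "nat \<Rightarrow> nat \<Rightarrow> com \<Rightarrow> com \<Rightarrow> com \<Rightarrow> com" where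
  "large_case B l PM PC PL = NAssign B (NReg 0) ;; PM ;;
     copy_cells (B+3) (B+1) (NConst 0) 0 (NConst 0) (NMul (NReg B) (NReg B)) ;;
     NAssign (B+1) (NReg B) ;; seq_list (replicate l (greedy_step B PC PL)) ;;
     copy_cells (B+3) 0 (NConst 0) (B+1) (NConst 0) (NMul (NReg (B+1)) (NReg B))"

definition large_time :: "nat \<Rightarrow> nat \<Rightarrow> nat \<Rightarrow> nat \<Rightarrow> nat \<Rightarrow> nat" where
  "large_time l TM TC TL n = 7 + 6 * (n * n) + TM + l * greedy_time TC TL n"

text \<open>The signs are built into the text. All constants being natural numbers, -1 is written as
  0 - 1. The program fills \<open>m\<close> cells, of which the oracle reads the first
  \<open>n\<close>.\<close>

definition query :: "nat \<Rightarrow> nat \<Rightarrow> bool list \<Rightarrow> nat \<Rightarrow> com" where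
  "query B m bs i = seq_list (map (\<lambda>j. RAssign 0 (NConst j)
       (if bs ! (i * m + j) then RSub (RNat (NConst 0)) (RNat (NConst 1)) else RNat (NConst 1))) [0..<m]) ;;
     Oracle 0 1 ;; copy_cells (B+3) B (NMul (NConst i) (NReg B)) 1 (NConst 0) (NReg B)"

text \<open>The text cannot depend on \<open>n\<close>, so \<open>m\<close> points are always
  fetched; the trial uses the first \<open>r\<close> of them.\<close>

definition candidate :: "nat \<Rightarrow> nat \<Rightarrow> com \<Rightarrow> com \<Rightarrow> bool list \<Rightarrow> com" where
  "candidate B m PC PL bs = seq_list (map (query B m bs) [0..<m]) ;; trial B PC PL"

definition candidate_time :: "nat \<Rightarrow> nat \<Rightarrow> nat \<Rightarrow> nat \<Rightarrow> nat" where
  "candidate_time m TC TL n = 1 + m * (4 + m + 3 * n) + trial_time TC TL n"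

text \<open>Each feasible point is the only oracle answer to some vector of signs. Hence, in dimension at most m,
  the signs in a list of length m * m produce every list of at most m feasible points.\<close>

definition sign_lists :: "nat \<Rightarrow> bool list list" where
  "sign_lists m = List.n_lists (m * m) [False, True]"

definition small_case :: "nat \<Rightarrow> nat \<Rightarrow> nat \<Rightarrow> com \<Rightarrow> com \<Rightarrow> com" where
  "small_case B m l PC PL = NAssign B (NReg 0) ;; NAssign (B+1) (NSub (NReg B) (NConst l)) ;;
     NAssign (B+2) (NConst 0) ;; seq_list (map (candidate B m PC PL) (sign_lists m)) ;;
     copy_cells (B+3) 0 (NConst 0) (B+2) (NConst 0) (NMul (NReg (B+1)) (NReg B))"

definition small_time :: "nat \<Rightarrow> nat \<Rightarrow> nat \<Rightarrow> nat \<Rightarrow> nat" where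
  "small_time m TC TL n = 6 + length (sign_lists m) * candidate_time m TC TL n + 3 * (n * n)"

section \<open>Correctness and running time of the programs, for one instance and one oracle\<close>

locale program_ctxt = instance_ctxt +
  fixes \<O> :: "real vec \<Rightarrow> real vec" and B TC TL :: nat and PC PL :: com
  assumes answers: "valid_oracle I \<O>"
    and B: "2 \<le> B"
    and fresh_regs: "wregs PC \<subseteq> {..<B}" "wregs PL \<subseteq> {..<B}"
    and fresh_arrs: "warrs PC \<subseteq> {..<B}" "warrs PL \<subseteq> {..<B}"
    and PC: "\<And>s. nreg s 0 = n \<Longrightarrow> 1 \<le> nreg s 1 \<Longrightarrow> nreg s 1 \<le> n \<Longrightarrow> set (rows_at n s 0 (nreg s 1)) \<subseteq> feas I \<Longrightarrow>
      \<exists>s'. reach n (descr I) \<O> PC s TC s' \<and> row_at n s' 1 0 \<in> conv_vecs n (rows_at n s 0 (nreg s 1))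
        \<and> (\<forall>y\<in>conv_vecs n (rows_at n s 0 (nreg s 1)). max_cost I (row_at n s' 1 0) \<le> max_cost I y)"
    and PL: "\<And>s. nreg s 0 = n \<Longrightarrow>
      \<exists>s'. reach n (descr I) \<O> PL s TL s' \<and> row_at n s' 1 0 \<in> unc I
        \<and> (\<forall>c\<in>unc I. row_at n s 0 0 \<bullet> c \<le> row_at n s 0 0 \<bullet> row_at n s' 1 0)"
begin

abbreviation run :: "com \<Rightarrow> store \<Rightarrow> nat \<Rightarrow> store \<Rightarrow> bool" where
  "run \<equiv> reach n (descr I) \<O>"

lemma fresh_wregs: "B \<le> v \<Longrightarrow> v \<notin> wregs PC" "B \<le> v \<Longrightarrow> v \<notin> wregs PL"
  and fresh_warrs: "B \<le> v \<Longrightarrow> v \<notin> warrs PC" "B \<le> v \<Longrightarrow> v \<notin> warrs PL"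
  using fresh_regs fresh_arrs by (auto simp: subset_iff not_less)

lemma frame_evaluate:
  "B \<le> v \<Longrightarrow> v \<noteq> B + 3 \<Longrightarrow> v \<notin> wregs (evaluate B PC PL)"
  "B \<le> v \<Longrightarrow> v \<noteq> B + 3 \<Longrightarrow> v \<noteq> B + 4 \<Longrightarrow> v \<notin> warrs (evaluate B PC PL)"
  using B fresh_wregs[of v] fresh_warrs[of v] by (auto simp: evaluate_def)

lemma frame_trial:
  "B \<le> v \<Longrightarrow> v \<noteq> B + 2 \<Longrightarrow> v \<noteq> B + 3 \<Longrightarrow> v \<notin> wregs (trial B PC PL)"
  "B \<le> v \<Longrightarrow> v \<noteq> B + 2 \<Longrightarrow> v \<noteq> B + 3 \<Longrightarrow> v \<noteq> B + 4 \<Longrightarrow> v \<notin> warrs (trial B PC PL)"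
  using frame_evaluate[of v] by (auto simp: trial_def)

text \<open>The convex subprogram delivers a minimiser \<open>x\<close> in array 1. It is saved in
  array \<open>B+3\<close>, since linear maximization puts the worst-case cost vector
  \<open>c\<close> into array 1 as well. The loop accumulates \<open>c \<bullet> x\<close>, which is
  \<open>max_cost I x\<close> and, by duality, the objective value.\<close>

lemma run_evaluate:
  assumes s: "nreg s B = n" "nreg s (B+1) = r" and r: "1 \<le> r" "r \<le> n"
    and xs: "rows_at n s B r = xs" "set xs \<subseteq> feas I"
  shows "\<exists>s'. run (evaluate B PC PL) s (eval_time TC TL n) s' \<and> arr s' (B+4) 0 = objective I xs
     \<and> arr s' (B+4) 1 = arr s (B+4) 1"
proof -
  obtain s1 where s1: "run (copy_cells (B+3) 0 (NConst 0) B (NConst 0) (NMul (NReg (B+1)) (NReg B))) s (2 + (r * n) * 3) s1"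
    "\<And>x. x < r * n \<Longrightarrow> arr s1 0 x = arr s B x"
    using reach_copy_cells[of B 0 "B+3" s "NConst 0" 0 "NConst 0" 0 "NMul (NReg (B+1)) (NReg B)" "r * n" n "descr I" \<O>] s B
    by auto
  have s1': "nreg s1 B = n" "nreg s1 (B+1) = r" "arr s1 (B+4) = arr s (B+4)"
    using reach_nreg[OF s1(1)] reach_arr[OF s1(1)] s B by auto
  define s3 where "s3 = set_nreg 1 r (set_nreg 0 n s1)"
  have s2: "run (NAssign 0 (NReg B)) s1 1 (set_nreg 0 n s1)" using reach_NAssign[of n "descr I" \<O> 0 "NReg B" s1] s1' by simp
  have s3: "run (NAssign 1 (NReg (B+1))) (set_nreg 0 n s1) 1 s3"
    using reach_NAssign[of n "descr I" \<O> 1 "NReg (B+1)" "set_nreg 0 n s1"] s1' by (simp add: s3_def)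
  have rows3: "rows_at n s3 0 r = xs" unfolding xs(1)[symmetric]
    by (rule rows_at_cong) (simp add: s3_def s1)
  obtain s4 where s4: "run PC s3 TC s4" "row_at n s4 1 0 \<in> conv_vecs n xs"
    "\<And>y. y \<in> conv_vecs n xs \<Longrightarrow> max_cost I (row_at n s4 1 0) \<le> max_cost I y"
    using PC[of s3] rows3 r xs(2) by (auto simp: s3_def)
  define x where "x = row_at n s4 1 0"
  have s4': "nreg s4 B = n" "arr s4 (B+4) = arr s (B+4)"
    using reach_nreg[OF s4(1) fresh_wregs(1)] reach_arr[OF s4(1) fresh_warrs(1)] s1' B by (auto simp: s3_def)
  obtain s5 where s5: "run (copy_cells (B+3) (B+3) (NConst 0) 1 (NConst 0) (NReg B)) s4 (2 + n * 3) s5"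
    "\<And>x. x < n \<Longrightarrow> arr s5 (B+3) x = arr s4 1 x"
    using reach_copy_cells[of 1 "B+3" "B+3" s4 "NConst 0" 0 "NConst 0" 0 "NReg B" n n "descr I" \<O>] s4' B by auto
  have s5': "nreg s5 B = n" "arr s5 (B+4) = arr s (B+4)" "arr s5 1 = arr s4 1"
    using reach_nreg[OF s5(1)] reach_arr[OF s5(1)] s4' B by auto
  obtain s6 where s6: "run (copy_cells (B+3) 0 (NConst 0) 1 (NConst 0) (NReg B)) s5 (2 + n * 3) s6"
    "\<And>x. x < n \<Longrightarrow> arr s6 0 x = arr s5 1 x"
    using reach_copy_cells[of 1 0 "B+3" s5 "NConst 0" 0 "NConst 0" 0 "NReg B" n n "descr I" \<O>] s5' B by auto
  have s6': "nreg s6 B = n" "arr s6 (B+4) = arr s (B+4)" "arr s6 (B+3) = arr s5 (B+3)"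
    using reach_nreg[OF s6(1)] reach_arr[OF s6(1)] s5' B by auto
  define s7 where "s7 = set_nreg 0 n s6"
  have s7: "run (NAssign 0 (NReg B)) s6 1 s7" using reach_NAssign[of n "descr I" \<O> 0 "NReg B" s6] s6' by (simp add: s7_def)
  have row7: "row_at n s7 0 0 = x" unfolding x_def
    by (rule row_at_cong) (use s6(2) s5' in \<open>simp add: s7_def\<close>)
  obtain s8 where s8: "run PL s7 TL s8" "row_at n s8 1 0 \<in> unc I"
    "\<And>c. c \<in> unc I \<Longrightarrow> x \<bullet> c \<le> x \<bullet> row_at n s8 1 0"
    using PL[of s7] row7 by (auto simp: s7_def)
  define c where "c = row_at n s8 1 0"
  have s8': "nreg s8 B = n" "arr s8 (B+4) = arr s (B+4)" "arr s8 (B+3) = arr s5 (B+3)"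
    using reach_nreg[OF s8(1) fresh_wregs(2)] reach_arr[OF s8(1) fresh_warrs(2)] s6' B by (auto simp: s7_def)
  define s9 where "s9 = set_cell (B+4) 0 0 s8"
  have s9: "run (RAssign (B+4) (NConst 0) (RNat (NConst 0))) s8 1 s9"
    using reach_RAssign[of n "descr I" \<O> "B+4" "NConst 0" "RNat (NConst 0)" s8] by (simp add: s9_def)
  have x: "x \<in> carrier_vec n" using s4(2) conv_vecs_carrier x_def by auto
  let ?P = "RAssign (B+4) (NConst 0)
       (RAdd (RCell (B+4) (NConst 0)) (RMul (RCell 1 (NReg (B+3))) (RCell (B+3) (NReg (B+3)))))"
  let ?Inv = "\<lambda>j (t :: store). nreg t B = n \<and> arr t 1 = arr s8 1 \<and> arr t (B+3) = arr s5 (B+3)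
     \<and> arr t (B+4) 1 = arr s (B+4) 1 \<and> arr t (B+4) 0 = (\<Sum>i = 0..<j. c $ i * x $ i)"
  have "\<exists>s'. run (for_loop (B+3) (NReg B) ?P) s9 (2 + n * (1 + 2)) s' \<and> ?Inv n s'"
  proof (rule reach_for_loop[where Inv = ?Inv])
    show "?Inv 0 (set_nreg (B+3) 0 s9)" using s8' B by (auto simp: s9_def)
  next
    fix j t assume *: "j < n" "?Inv j t" "nreg t (B+3) = j"
    let ?t = "set_cell (B+4) 0 (arr t (B+4) 0 + arr t 1 j * arr t (B+3) j) t"
    have "c $ j = arr t 1 j" using * by (simp add: c_def row_at_def)
    moreover have "x $ j = arr t (B+3) j" using * by (simp add: x_def row_at_def s5(2))
    ultimately have inv: "?Inv (Suc j) (set_nreg (B+3) (Suc j) ?t)" using * B by auto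
    have "run ?P t 1 ?t"
      using reach_RAssign[of n "descr I" \<O> "B+4" "NConst 0"
        "RAdd (RCell (B+4) (NConst 0)) (RMul (RCell 1 (NReg (B+3))) (RCell (B+3) (NReg (B+3))))" t] * by simp
    moreover have "nreg ?t (B+3) = j" using * by simp
    ultimately show "\<exists>s'. run ?P t 1 s' \<and> nreg s' (B+3) = j \<and> ?Inv (Suc j) (set_nreg (B+3) (Suc j) s')"
      using inv by blast
  qed simp
  then obtain s' where s': "run (for_loop (B+3) (NReg B) ?P) s9 (2 + n * 3) s'" "?Inv n s'"
    by (auto simp: numeral_3_eq_3)
  have "max_cost I x = objective I xs"
    by (rule max_cost_minimiser) (use s4(2,3) xs(2) rows3 r in \<open>auto simp: x_def rows_at_def\<close>)
  moreover have "max_cost I x = c \<bullet> x"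
    by (rule max_cost_eqI[OF x]) (use s8 in \<open>auto simp: c_def\<close>)
  ultimately have "objective I xs = (\<Sum>i = 0..<n. c $ i * x $ i)" using x by (simp add: scalar_prod_def)
  moreover have "run (evaluate B PC PL) s (eval_time TC TL n) s'"
    unfolding evaluate_def
  proof (rule reach_mono[OF reach_Seq[OF s1(1) reach_Seq[OF s2 reach_Seq[OF s3 reach_Seq[OF s4(1)
      reach_Seq[OF s5(1) reach_Seq[OF s6(1) reach_Seq[OF s7 reach_Seq[OF s8(1) reach_Seq[OF s9 s'(1)]]]]]]]]]])
    have "r * n \<le> n * n" using r by simp
    then show "2 + r * n * 3 + (1 + (1 + (TC + (2 + n * 3 + (2 + n * 3 + (1 + (TL + (1 + (2 + n * 3)))))))))
       \<le> eval_time TC TL n" by (simp add: eval_time_def)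
  qed
  ultimately show ?thesis using s'(2) by auto
qed

text \<open>Invariant of a running minimum. The set \<open>S\<close> of lists tried so far exists in
  the proof only; flag 0 stands for no list tried.\<close>

definition best_of :: "nat \<Rightarrow> store \<Rightarrow> real vec list set \<Rightarrow> bool" where
  "best_of r s S \<longleftrightarrow> (if nreg s (B+2) = 0 then S = {} else
     rows_at n s (B+2) r \<in> S \<and> arr s (B+4) 1 = objective I (rows_at n s (B+2) r)
     \<and> (\<forall>ys\<in>S. objective I (rows_at n s (B+2) r) \<le> objective I ys))"

lemma best_of_cong:
  assumes "nreg s (B+2) = nreg s' (B+2)" "arr s (B+2) = arr s' (B+2)" "arr s (B+4) 1 = arr s' (B+4) 1"
  shows "best_of r s S \<longleftrightarrow> best_of r s' S"
proof -
  have "rows_at n s (B+2) r = rows_at n s' (B+2) r" by (rule rows_at_cong) (use assms in simp)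
  then show ?thesis using assms by (simp add: best_of_def)
qed

lemma run_trial:
  assumes s: "nreg s B = n" "nreg s (B+1) = r" and r: "1 \<le> r" "r \<le> n"
    and xs: "rows_at n s B r = xs" "set xs \<subseteq> feas I" and S: "best_of r s S"
  shows "\<exists>s'. run (trial B PC PL) s (trial_time TC TL n) s' \<and> best_of r s' (insert xs S)"
proof -
  obtain s1 where s1: "run (evaluate B PC PL) s (eval_time TC TL n) s1" "arr s1 (B+4) 0 = objective I xs"
     "arr s1 (B+4) 1 = arr s (B+4) 1"
    using run_evaluate[OF s r xs] by blast
  have s1': "nreg s1 B = n" "nreg s1 (B+1) = r" "nreg s1 (B+2) = nreg s (B+2)" "arr s1 B = arr s B"
    "arr s1 (B+2) = arr s (B+2)"
    using reach_nreg[OF s1(1) frame_evaluate(1)] reach_arr[OF s1(1) frame_evaluate(2)] s B by auto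
  have S1: "best_of r s1 S" using best_of_cong[of s1 s] s1' s1(3) S by auto
  let ?b = "BAnd (NLess (NConst 0) (NReg (B+2))) (BNot (RLess (RCell (B+4) (NConst 0)) (RCell (B+4) (NConst 1))))"
  have rn: "r * n \<le> n * n" using r by simp
  show ?thesis
  proof (cases "bval (descr I) ?b s1")
    case True
    have "run (trial B PC PL) s (trial_time TC TL n) s1" unfolding trial_def
      by (rule reach_mono[OF reach_Seq[OF s1(1) reach_CondTrue[OF True reach_Skip]]]) (simp add: trial_time_def)
    moreover have "best_of r s1 (insert xs S)" using True S1 s1(2) by (auto simp: best_of_def)
    ultimately show ?thesis by blast
  next
    case False
    define s2 where "s2 = set_cell (B+4) 1 (arr s1 (B+4) 0) s1"
    define s3 where "s3 = set_nreg (B+2) 1 s2"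
    have s2: "run (RAssign (B+4) (NConst 1) (RCell (B+4) (NConst 0))) s1 1 s2"
      using reach_RAssign[of n "descr I" \<O> "B+4" "NConst 1" "RCell (B+4) (NConst 0)" s1] by (simp add: s2_def)
    have s3: "run (NAssign (B+2) (NConst 1)) s2 1 s3"
      using reach_NAssign[of n "descr I" \<O> "B+2" "NConst 1" s2] by (simp add: s3_def)
    obtain s4 where s4: "run (copy_cells (B+3) (B+2) (NConst 0) B (NConst 0) (NMul (NReg (B+1)) (NReg B))) s3 (2 + (r * n) * 3) s4"
      "\<And>x. x < r * n \<Longrightarrow> arr s4 (B+2) x = arr s3 B x"
      using reach_copy_cells[of B "B+2" "B+3" s3 "NConst 0" 0 "NConst 0" 0 "NMul (NReg (B+1)) (NReg B)" "r * n" n "descr I" \<O>] s1'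
      by (auto simp: s2_def s3_def)
    have s4': "nreg s4 (B+2) = 1" "arr s4 (B+4) 1 = objective I xs"
      using reach_nreg[OF s4(1)] reach_arr[OF s4(1)] s1(2) by (auto simp: s2_def s3_def)
    have "rows_at n s4 (B+2) r = xs" unfolding xs(1)[symmetric]
      by (rule rows_at_cong) (use s4(2) s1' in \<open>simp add: s2_def s3_def\<close>)
    \<comment> \<open>Failure of the test means that \<open>S\<close> is empty or that
      \<open>xs\<close> beats the stored value strictly.\<close>
    moreover have "objective I xs \<le> objective I ys" if "ys \<in> S" for ys
      using False S1 s1(2) that by (force simp: best_of_def split: if_splits)
    ultimately have "best_of r s4 (insert xs S)" using s4' by (auto simp: best_of_def)
    moreover have "run (trial B PC PL) s (trial_time TC TL n) s4" unfolding trial_def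
      by (rule reach_mono[OF reach_Seq[OF s1(1) reach_CondFalse[OF False reach_Seq[OF s2 reach_Seq[OF s3 s4(1)]]]]])
        (use rn in \<open>simp add: trial_time_def\<close>)
    ultimately show ?thesis by blast
  qed
qed

lemma run_greedy_step:
  assumes s: "nreg s B = n" "nreg s (B+1) = Suc r" and r: "1 \<le> r" "Suc r \<le> n"
    and xs: "rows_at n s (B+1) (Suc r) = xs" "set xs \<subseteq> feas I"
  shows "\<exists>s'. run (greedy_step B PC PL) s (greedy_time TC TL n) s' \<and> nreg s' B = n \<and> nreg s' (B+1) = r
     \<and> (\<exists>j. rows_at n s' (B+1) r = drop_nth j xs
          \<and> (\<forall>i<length xs. objective I (drop_nth j xs) \<le> objective I (drop_nth i xs)))"
proof -
  have rn: "r * n \<le> n * n" using r by simp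
  define s1 where "s1 = set_nreg (B+1) r s"
  define s2 where "s2 = set_nreg (B+2) 0 s1"
  have s1: "run (NAssign (B+1) (NSub (NReg (B+1)) (NConst 1))) s 1 s1"
    using reach_NAssign[of n "descr I" \<O> "B+1" "NSub (NReg (B+1)) (NConst 1)" s] s by (simp add: s1_def)
  have s2: "run (NAssign (B+2) (NConst 0)) s1 1 s2"
    using reach_NAssign[of n "descr I" \<O> "B+2" "NConst 0" s1] by (simp add: s2_def)
  define T where "T = 4 + 3 * (n * n) + 3 * n + trial_time TC TL n"
  let ?P1 = "copy_cells (B+3) B (NConst 0) (B+1) (NConst 0) (NMul (NReg (B+1)) (NReg B))"
  let ?P2 = "copy_cells (B+3) B (NMul (NReg (B+4)) (NReg B)) (B+1) (NMul (NReg (B+1)) (NReg B)) (NReg B)"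
  let ?P = "?P1 ;; ?P2 ;; trial B PC PL"
  let ?Inv = "\<lambda>j (t :: store). nreg t B = n \<and> nreg t (B+1) = r \<and> arr t (B+1) = arr s (B+1)
     \<and> best_of r t ((\<lambda>i. drop_nth i xs) ` {..<j})"
  have "\<exists>s'. run (for_loop (B+4) (NAdd (NReg (B+1)) (NConst 1)) ?P) s2 (2 + Suc r * (T + 2)) s' \<and> ?Inv (Suc r) s'"
  proof (rule reach_for_loop[where Inv = ?Inv])
    show "?Inv 0 (set_nreg (B+4) 0 s2)" using s by (simp add: s2_def s1_def best_of_def)
  next
    fix j t assume j: "j < Suc r" "nreg t (B+4) = j" and inv: "?Inv j t"
    obtain t1 where t1: "run ?P1 t (2 + (r * n) * 3) t1" "\<And>x. x < r * n \<Longrightarrow> arr t1 B x = arr t (B+1) x"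
      using reach_copy_cells[of "B+1" B "B+3" t "NConst 0" 0 "NConst 0" 0 "NMul (NReg (B+1)) (NReg B)" "r * n" n "descr I" \<O>] inv
      by auto
    have t1': "nreg t1 B = n" "nreg t1 (B+1) = r" "nreg t1 (B+2) = nreg t (B+2)" "nreg t1 (B+4) = j"
      "arr t1 (B+1) = arr s (B+1)" "arr t1 (B+2) = arr t (B+2)" "arr t1 (B+4) = arr t (B+4)"
      using reach_nreg[OF t1(1)] reach_arr[OF t1(1)] inv j by auto
    obtain t2 where t2: "run ?P2 t1 (2 + n * 3) t2" "\<And>x. x < n \<Longrightarrow> arr t2 B (j * n + x) = arr t1 (B+1) (r * n + x)"
      "\<And>x. \<not> (j * n \<le> x \<and> x < j * n + n) \<Longrightarrow> arr t2 B x = arr t1 B x"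
      using reach_copy_cells[of "B+1" B "B+3" t1 "NMul (NReg (B+4)) (NReg B)" "j * n" "NMul (NReg (B+1)) (NReg B)" "r * n" "NReg B" n n "descr I" \<O>] t1'
      by auto
    have t2': "nreg t2 B = n" "nreg t2 (B+1) = r" "nreg t2 (B+2) = nreg t (B+2)" "nreg t2 (B+4) = j"
      "arr t2 (B+1) = arr s (B+1)" "arr t2 (B+2) = arr t (B+2)" "arr t2 (B+4) = arr t (B+4)"
      using reach_nreg[OF t2(1)] reach_arr[OF t2(1)] t1' by auto
    have lx: "length xs = Suc r" using xs(1) by auto
    have rows: "rows_at n t2 B r = drop_nth j xs"
    proof (rule nth_equalityI)
      fix i assume "i < length (rows_at n t2 B r)"
      then have i: "i < r" by simp
      have "last xs = row_at n s (B+1) r"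
        using lx xs(1) by (metis diff_Suc_1 last_conv_nth length_0_conv lessI nat.distinct(1) nth_rows_at)
      moreover have "xs ! i = row_at n s (B+1) i" using i xs(1) by (metis less_SucI nth_rows_at)
      \<comment> \<open>The second copy affects row \<open>j\<close> only; if \<open>j = r\<close>,
        the case \<open>i = j\<close> does not arise, in agreement with
        \<open>drop_nth\<close>.\<close>
      moreover have "row_at n t2 B i = (if i = j then row_at n s (B+1) r else row_at n s (B+1) i)"
      proof (cases "i = j")
        case True
        then show ?thesis using t2(2) t1' by (auto intro!: row_at_cong)
      next
        case False
        have "row_at n t2 B i = row_at n s (B+1) i"
        proof (rule row_at_cong)
          fix x assume "x < n"
          then show "arr t2 B (i * n + x) = arr s (B+1) (i * n + x)"
            using t2(3)[OF cell_neq[OF False]] t1(2)[OF cell_less[OF i]] inv by simp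
        qed
        then show ?thesis using False by simp
      qed
      ultimately show "rows_at n t2 B r ! i = drop_nth j xs ! i" using i lx by (simp add: drop_nth_def)
    qed (simp add: lx)
    have "best_of r t2 ((\<lambda>i. drop_nth i xs) ` {..<j})"
      using inv best_of_cong[of t2 t] t2' by simp
    then obtain t3 where t3: "run (trial B PC PL) t2 (trial_time TC TL n) t3"
      "best_of r t3 (insert (drop_nth j xs) ((\<lambda>i. drop_nth i xs) ` {..<j}))"
      using run_trial[OF t2'(1,2) r(1) _ rows] r(2) set_drop_nth_subset[of j xs] xs(2)
      by (metis Suc_leD order_trans)
    have t3': "nreg t3 B = n" "nreg t3 (B+1) = r" "nreg t3 (B+4) = j" "arr t3 (B+1) = arr s (B+1)"
      using reach_nreg[OF t3(1) frame_trial(1)] reach_arr[OF t3(1) frame_trial(2)] t2' by auto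
    have "run ?P t T t3"
      by (rule reach_mono[OF reach_Seq[OF t1(1) reach_Seq[OF t2(1) t3(1)]]]) (use rn in \<open>simp add: T_def\<close>)
    moreover have "best_of r (set_nreg (B+4) (Suc j) t3) ((\<lambda>i. drop_nth i xs) ` {..<Suc j})"
      using t3(2) best_of_cong[of "set_nreg (B+4) (Suc j) t3" t3] by (simp add: lessThan_Suc)
    ultimately show "\<exists>s'. run ?P t T s' \<and> nreg s' (B+4) = j \<and> ?Inv (Suc j) (set_nreg (B+4) (Suc j) s')"
      using t3' by (intro exI[of _ t3]) simp
  qed simp
  then obtain s3 where s3: "run (for_loop (B+4) (NAdd (NReg (B+1)) (NConst 1)) ?P) s2 (2 + Suc r * (T + 2)) s3"
    "?Inv (Suc r) s3" by blast
  obtain j where j: "rows_at n s3 (B+2) r = drop_nth j xs" "\<And>i. i < Suc r \<Longrightarrow> objective I (drop_nth j xs) \<le> objective I (drop_nth i xs)"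
  proof -
    have "best_of r s3 ((\<lambda>i. drop_nth i xs) ` {..<Suc r})" using s3(2) by blast
    then have "rows_at n s3 (B+2) r \<in> (\<lambda>i. drop_nth i xs) ` {..<Suc r}"
      "\<forall>ys\<in>(\<lambda>i. drop_nth i xs) ` {..<Suc r}. objective I (rows_at n s3 (B+2) r) \<le> objective I ys"
      unfolding best_of_def by (auto split: if_splits)
    then show ?thesis using that by auto
  qed
  obtain s4 where s4: "run (copy_cells (B+3) (B+1) (NConst 0) (B+2) (NConst 0) (NMul (NReg (B+1)) (NReg B))) s3 (2 + (r * n) * 3) s4"
      "\<And>x. x < r * n \<Longrightarrow> arr s4 (B+1) x = arr s3 (B+2) x"
    using reach_copy_cells[of "B+2" "B+1" "B+3" s3 "NConst 0" 0 "NConst 0" 0 "NMul (NReg (B+1)) (NReg B)" "r * n" n "descr I" \<O>] s3(2)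
    by auto
  have s4': "nreg s4 B = n" "nreg s4 (B+1) = r" using reach_nreg[OF s4(1)] s3(2) by auto
  have "rows_at n s4 (B+1) r = drop_nth j xs" unfolding j(1)[symmetric]
    by (rule rows_at_cong) (use s4(2) in simp)
  moreover have "run (greedy_step B PC PL) s (greedy_time TC TL n) s4"
    unfolding greedy_step_def
  proof (rule reach_mono[OF reach_Seq[OF s1 reach_Seq[OF s2 reach_Seq[OF s3(1) s4(1)]]]])
    have "Suc r * (T + 2) \<le> n * (T + 2)" using r by (intro mult_le_mono1)
    moreover have "greedy_time TC TL n = 6 + 3 * (n * n) + n * (T + 2)"
      by (simp add: greedy_time_def T_def)
    ultimately show "1 + (1 + (2 + Suc r * (T + 2) + (2 + r * n * 3))) \<le> greedy_time TC TL n"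
      using rn by linarith
  qed
  moreover have "length xs = Suc r" using xs(1) by auto
  ultimately show ?thesis using s4' j(2) by auto
qed

lemma run_large_case:
  assumes PM: "\<And>s. nreg s 0 = n \<Longrightarrow> \<exists>s'. run PM s TM s' \<and> rows_at n s' 0 n \<in> solutions I n
      \<and> objective I (rows_at n s' 0 n) = opt I n"
    and fresh: "wregs PM \<subseteq> {..<B}" "warrs PM \<subseteq> {..<B}"
    and s: "nreg s 0 = n" and l: "l < n"
    and M: "0 \<le> M" "\<And>c. c \<in> unc I \<Longrightarrow> norm_inf c \<le> M"
    and p: "\<And>x. x \<in> feas I \<Longrightarrow> real (norm0 x) \<le> p"
  shows "\<exists>s'. run (large_case B l PM PC PL) s (large_time l TM TC TL n) s'
     \<and> rows_at n s' 0 (n - l) \<in> solutions I (n - l)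
     \<and> objective I (rows_at n s' 0 (n - l)) \<le> opt I n + real l * (M * p / real (n - l + 1))"
proof -
  have p0: "0 \<le> p" using p feas_ne by (metis all_not_in_conv of_nat_0_le_iff order_trans)
  define s1 where "s1 = set_nreg B n s"
  have s1: "run (NAssign B (NReg 0)) s 1 s1"
    using reach_NAssign[of n "descr I" \<O> B "NReg 0" s] s by (simp add: s1_def)
  obtain s2 where s2: "run PM s1 TM s2" "rows_at n s2 0 n \<in> solutions I n" "objective I (rows_at n s2 0 n) = opt I n"
    using PM[of s1] s B by (auto simp: s1_def)
  have s2': "nreg s2 B = n" using reach_nreg[OF s2(1), of B] fresh by (auto simp: s1_def)
  obtain s3 where s3: "run (copy_cells (B+3) (B+1) (NConst 0) 0 (NConst 0) (NMul (NReg B) (NReg B))) s2 (2 + (n * n) * 3) s3"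
      "\<And>x. x < n * n \<Longrightarrow> arr s3 (B+1) x = arr s2 0 x"
    using reach_copy_cells[of 0 "B+1" "B+3" s2 "NConst 0" 0 "NConst 0" 0 "NMul (NReg B) (NReg B)" "n * n" n "descr I" \<O>] s2'
    by auto
  have s3': "nreg s3 B = n" using reach_nreg[OF s3(1)] s2' by auto
  define s4 where "s4 = set_nreg (B+1) n s3"
  have s4: "run (NAssign (B+1) (NReg B)) s3 1 s4"
    using reach_NAssign[of n "descr I" \<O> "B+1" "NReg B" s3] s3' by (simp add: s4_def)
  have rows4: "rows_at n s4 (B+1) n = rows_at n s2 0 n"
    by (rule rows_at_cong) (use s3(2) in \<open>simp add: s4_def\<close>)
  \<comment> \<open>The shortest list from which a point is removed has \<open>n - l + 1\<close>
    points, so this bounds the loss of each of the \<open>l\<close> removals.\<close>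
  define loss where "loss = M * p / real (n - l + 1)"
  let ?Inv = "\<lambda>i (t :: store). nreg t B = n \<and> nreg t (B+1) = n - i \<and> set (rows_at n t (B+1) (n - i)) \<subseteq> feas I
     \<and> objective I (rows_at n t (B+1) (n - i)) \<le> opt I n + real i * loss"
  have "\<exists>s'. run (seq_list (replicate l (greedy_step B PC PL))) s4
       (1 + length (replicate l (greedy_step B PC PL)) * greedy_time TC TL n) s'
     \<and> ?Inv (length (replicate l (greedy_step B PC PL))) s'"
  proof (rule reach_seq_list[where Inv = ?Inv])
    show "?Inv 0 s4" using s3' s2 rows4 by (simp add: s4_def solutions_def)
  next
    fix i t assume i: "i < length (replicate l (greedy_step B PC PL))" and inv: "?Inv i t"
    define r where "r = n - Suc i"
    have r: "n - i = Suc r" "1 \<le> r" "Suc r \<le> n" "n - l + 1 \<le> Suc r" using i l by (auto simp: r_def)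
    define xs where "xs = rows_at n t (B+1) (Suc r)"
    have lx: "length xs = Suc r" by (simp add: xs_def)
    have xs: "set xs \<subseteq> feas I" using inv r(1) by (simp add: xs_def)
    obtain t' j where t': "run (greedy_step B PC PL) t (greedy_time TC TL n) t'" "nreg t' B = n" "nreg t' (B+1) = r"
      "rows_at n t' (B+1) r = drop_nth j xs" "\<And>i. i < Suc r \<Longrightarrow> objective I (drop_nth j xs) \<le> objective I (drop_nth i xs)"
      using run_greedy_step[of t r xs] inv r lx xs by (auto simp: xs_def)
    \<comment> \<open>The index \<open>k\<close> of a point of small weight is unknown to the
      program, but the greedy choice \<open>j\<close> is at least as good.\<close>
    obtain k where k: "k < Suc r" "objective I (drop_nth k xs) \<le> objective I xs + M * p / real (Suc r)"
      using ex_drop_nth[of xs M p] lx r(2) xs M p by auto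
    have "M * p / real (Suc r) \<le> loss" unfolding loss_def
      by (rule divide_left_mono) (use r(4) M p0 in auto)
    then have "objective I (drop_nth j xs) \<le> opt I n + real (Suc i) * loss"
      using t'(5)[OF k(1)] k(2) inv r(1) by (simp add: xs_def algebra_simps)
    then have "?Inv (Suc i) t'" using t' set_drop_nth_subset[of j xs] xs by (simp add: r_def)
    then show "\<exists>s'. run (replicate l (greedy_step B PC PL) ! i) t (greedy_time TC TL n) s' \<and> ?Inv (Suc i) s'"
      using t'(1) i by auto
  qed
  then obtain s5 where s5: "run (seq_list (replicate l (greedy_step B PC PL))) s4 (1 + l * greedy_time TC TL n) s5"
    "?Inv l s5" by auto
  let ?k = "n - l"
  obtain s6 where s6: "run (copy_cells (B+3) 0 (NConst 0) (B+1) (NConst 0) (NMul (NReg (B+1)) (NReg B))) s5 (2 + (?k * n) * 3) s6"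
      "\<And>x. x < ?k * n \<Longrightarrow> arr s6 0 x = arr s5 (B+1) x"
    using reach_copy_cells[of "B+1" 0 "B+3" s5 "NConst 0" 0 "NConst 0" 0 "NMul (NReg (B+1)) (NReg B)" "?k * n" n "descr I" \<O>] s5(2)
    by auto
  have rows6: "rows_at n s6 0 ?k = rows_at n s5 (B+1) ?k"
    by (rule rows_at_cong) (use s6(2) in simp)
  then have "rows_at n s6 0 ?k \<in> solutions I ?k" using s5(2) by (simp add: solutions_def)
  moreover have "objective I (rows_at n s6 0 ?k) \<le> opt I n + real l * (M * p / real (n - l + 1))"
    using s5(2) rows6 unfolding loss_def by simp
  moreover have "run (large_case B l PM PC PL) s (large_time l TM TC TL n) s6"
    unfolding large_case_def
  proof (rule reach_mono[OF reach_Seq[OF s1 reach_Seq[OF s2(1) reach_Seq[OF s3(1) reach_Seq[OF s4 reach_Seq[OF s5(1) s6(1)]]]]]])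
    have "?k * n \<le> n * n" by simp
    then show "1 + (TM + (2 + n * n * 3 + (1 + (1 + l * greedy_time TC TL n + (2 + ?k * n * 3))))) \<le> large_time l TM TC TL n"
      by (simp add: large_time_def)
  qed
  ultimately show ?thesis by blast
qed

section \<open>Exhaustive search in small dimensions\<close>

definition points :: "nat \<Rightarrow> bool list \<Rightarrow> nat \<Rightarrow> real vec list" where
  "points m bs r = map (\<lambda>i. \<O> (vec n (\<lambda>j. if bs ! (i * m + j) then - 1 else 1))) [0..<r]"

text \<open>Whatever the signs, an answer of the oracle is feasible, so the enumeration can do
  without a feasibility test.\<close>

lemma set_points: "set (points m bs r) \<subseteq> feas I"
  using answers by (auto simp: points_def valid_oracle_def dim)

lemma points_surj:
  assumes xs: "xs \<in> solutions I r" and m: "r \<le> m" "n \<le> m"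
  shows "\<exists>bs\<in>set (sign_lists m). points m bs r = xs"
proof -
  \<comment> \<open>Bit \<open>i * m + j\<close> records whether coordinate \<open>j\<close> of
    point \<open>i\<close> is 1. Bits with \<open>i \<ge> r\<close> or \<open>j \<ge> n\<close> may
    come from list or vector accesses out of range; \<open>points m bs r\<close> never reads
    them.\<close>
  define bs where "bs = map (\<lambda>x. xs ! (x div m) $ (x mod m) = 1) [0..<m * m]"
  have bs: "bs ! (i * m + j) \<longleftrightarrow> xs ! i $ j = 1" if "i < r" "j < n" for i j
  proof -
    have "j < m" "i * m + j < m * m" using that m by (auto intro: cell_less)
    then show ?thesis by (simp add: bs_def)
  qed
  have "points m bs r = xs"
  proof (rule nth_equalityI)
    fix i assume "i < length (points m bs r)"
    then have i: "i < r" by (simp add: points_def)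
    then have "xs ! i \<in> feas I" using xs nth_mem by (fastforce simp: solutions_def)
    then show "points m bs r ! i = xs ! i" using i bs
      by (auto simp: points_def intro!: oracle_sign_vector[OF answers])
  qed (use xs in \<open>simp add: points_def solutions_def\<close>)
  moreover have "bs \<in> set (sign_lists m)" by (auto simp: sign_lists_def set_n_lists bs_def)
  ultimately show ?thesis by blast
qed

lemma run_query:
  assumes s: "nreg s B = n" and m: "n \<le> m"
  shows "\<exists>s'. run (query B m bs i) s (4 + m + 3 * n) s'
     \<and> row_at n s' B i = \<O> (vec n (\<lambda>j. if bs ! (i * m + j) then - 1 else 1))
     \<and> (\<forall>k. k \<noteq> i \<longrightarrow> row_at n s' B k = row_at n s B k)"
proof -
  let ?c = "\<lambda>j. if bs ! (i * m + j) then - 1 else (1 :: real)"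
  let ?e = "\<lambda>j. if bs ! (i * m + j) then RSub (RNat (NConst 0)) (RNat (NConst 1)) else RNat (NConst 1)"
  let ?Ps = "map (\<lambda>j. RAssign 0 (NConst j) (?e j)) [0..<m]"
  have "\<exists>s'. run (seq_list ?Ps) s (1 + length ?Ps * 1) s' \<and> (\<forall>j<length ?Ps. arr s' 0 j = ?c j)"
  proof (rule reach_seq_list[where Inv = "\<lambda>i t. \<forall>j<i. arr t 0 j = ?c j"])
    fix j and t :: store assume j: "j < length ?Ps" and inv: "\<forall>i<j. arr t 0 i = ?c i"
    have "rval (descr I) (?e j) t = ?c j" by simp
    then have "run (?Ps ! j) t 1 (set_cell 0 j (?c j) t)"
      using reach_RAssign[of n "descr I" \<O> 0 "NConst j" "?e j" t] j by simp
    moreover have "\<forall>i<Suc j. arr (set_cell 0 j (?c j) t) 0 i = ?c i" using inv by (simp add: less_Suc_eq)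
    ultimately show "\<exists>s'. run (?Ps ! j) t 1 s' \<and> (\<forall>i<Suc j. arr s' 0 i = ?c i)" by blast
  qed simp
  then obtain s1 where s1: "run (seq_list ?Ps) s (1 + m) s1" "\<And>j. j < m \<Longrightarrow> arr s1 0 j = ?c j" by auto
  have s1': "nreg s1 B = n" "arr s1 B = arr s B" using reach_nreg[OF s1(1)] reach_arr[OF s1(1)] s B by auto
  have row1: "row_at n s1 0 0 = vec n ?c" using s1(2) m by (auto simp: row_at_def)
  define x where "x = \<O> (vec n ?c)"
  define s2 where "s2 = store_vec n 1 x s1"
  have s2: "run (Oracle 0 1) s1 1 s2"
    using reach_Oracle[of n "descr I" \<O> 0 1 s1] row1 by (simp add: s2_def x_def)
  obtain s3 where s3: "run (copy_cells (B+3) B (NMul (NConst i) (NReg B)) 1 (NConst 0) (NReg B)) s2 (2 + n * 3) s3"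
      "\<And>j. j < n \<Longrightarrow> arr s3 B (i * n + j) = arr s2 1 j"
      "\<And>j. \<not> (i * n \<le> j \<and> j < i * n + n) \<Longrightarrow> arr s3 B j = arr s2 B j"
    using reach_copy_cells[of 1 B "B+3" s2 "NMul (NConst i) (NReg B)" "i * n" "NConst 0" 0 "NReg B" n n "descr I" \<O>] s1' B
    by (auto simp: s2_def)
  have "x \<in> carrier_vec n" using answers feas_carrier by (auto simp: x_def valid_oracle_def dim)
  then have "row_at n s3 B i = x" using s3(2) by (auto simp: row_at_def s2_def)
  moreover have "row_at n s3 B k = row_at n s B k" if "k \<noteq> i" for k
    using s3(3)[OF cell_neq[OF that]] s1' B by (intro row_at_cong) (simp add: s2_def)
  moreover have "run (query B m bs i) s (4 + m + 3 * n) s3" unfolding query_def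
    by (rule reach_mono[OF reach_Seq[OF s1(1) reach_Seq[OF s2 s3(1)]]]) simp
  ultimately show ?thesis unfolding x_def by blast
qed

lemma frame_query: "v \<noteq> B + 3 \<Longrightarrow> v \<notin> wregs (query B m bs i)" "v \<noteq> 0 \<Longrightarrow> v \<noteq> 1 \<Longrightarrow> v \<noteq> B \<Longrightarrow> v \<notin> warrs (query B m bs i)"
  by (auto simp: query_def)

lemma run_candidate:
  assumes s: "nreg s B = n" "nreg s (B+1) = r" and r: "1 \<le> r" "r \<le> n" and m: "n \<le> m" and S: "best_of r s S"
  shows "\<exists>s'. run (candidate B m PC PL bs) s (candidate_time m TC TL n) s' \<and> nreg s' B = n \<and> nreg s' (B+1) = r
     \<and> best_of r s' (insert (points m bs r) S)"
proof -
  let ?Ps = "map (query B m bs) [0..<m]"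
  let ?x = "\<lambda>i. \<O> (vec n (\<lambda>j. if bs ! (i * m + j) then - 1 else 1))"
  let ?Inv = "\<lambda>i (t :: store). nreg t B = n \<and> (\<forall>k<i. row_at n t B k = ?x k)"
  have "\<exists>s'. run (seq_list ?Ps) s (1 + length ?Ps * (4 + m + 3 * n)) s' \<and> ?Inv (length ?Ps) s'"
  proof (rule reach_seq_list[where Inv = ?Inv])
    fix i t assume i: "i < length ?Ps" and inv: "?Inv i t"
    obtain t' where t': "run (query B m bs i) t (4 + m + 3 * n) t'" "row_at n t' B i = ?x i"
      "\<And>k. k \<noteq> i \<Longrightarrow> row_at n t' B k = row_at n t B k" using run_query[of t m bs i] inv m by blast
    have "?Inv (Suc i) t'" using t'(2,3) inv reach_nreg[OF t'(1) frame_query(1)] by (auto simp: less_Suc_eq)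
    then show "\<exists>s'. run (?Ps ! i) t (4 + m + 3 * n) s' \<and> ?Inv (Suc i) s'" using t'(1) i by auto
  qed (use s in simp)
  then obtain s1 where s1: "run (seq_list ?Ps) s (1 + m * (4 + m + 3 * n)) s1" "?Inv m s1" by auto
  have s1': "nreg s1 B = n" "nreg s1 (B+1) = r" "nreg s1 (B+2) = nreg s (B+2)" "arr s1 (B+2) = arr s (B+2)" "arr s1 (B+4) = arr s (B+4)"
    using reach_nreg[OF s1(1)] reach_arr[OF s1(1)] s frame_query B by auto
  have S1: "best_of r s1 S" using best_of_cong[of s1 s] s1' S by auto
  have rows: "rows_at n s1 B r = points m bs r" using s1(2) r m by (simp add: rows_at_def points_def)
  obtain s2 where s2: "run (trial B PC PL) s1 (trial_time TC TL n) s2" "best_of r s2 (insert (points m bs r) S)"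
    using run_trial[OF s1'(1,2) r rows set_points S1] by blast
  have "nreg s2 B = n" "nreg s2 (B+1) = r" using reach_nreg[OF s2(1) frame_trial(1)] s1' by auto
  moreover have "run (candidate B m PC PL bs) s (candidate_time m TC TL n) s2" unfolding candidate_def
    by (rule reach_mono[OF reach_Seq[OF s1(1) s2(1)]]) (simp add: candidate_time_def)
  ultimately show ?thesis using s2(2) by blast
qed

text \<open>Every list tried is a solution and, by \<open>points_surj\<close>, an optimal one is
  among them, so the result is exact.\<close>

lemma run_small_case:
  assumes s: "nreg s 0 = n" and l: "l < n" and m: "n \<le> m"
  shows "\<exists>s'. run (small_case B m l PC PL) s (small_time m TC TL n) s'
     \<and> rows_at n s' 0 (n - l) \<in> solutions I (n - l)
     \<and> objective I (rows_at n s' 0 (n - l)) = opt I (n - l)"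
proof -
  let ?k = "n - l"
  define s1 where "s1 = set_nreg B n s"
  define s2 where "s2 = set_nreg (B+1) ?k s1"
  define s3 where "s3 = set_nreg (B+2) 0 s2"
  have s1: "run (NAssign B (NReg 0)) s 1 s1"
    using reach_NAssign[of n "descr I" \<O> B "NReg 0" s] s by (simp add: s1_def)
  have s2: "run (NAssign (B+1) (NSub (NReg B) (NConst l))) s1 1 s2"
    using reach_NAssign[of n "descr I" \<O> "B+1" "NSub (NReg B) (NConst l)" s1] by (simp add: s1_def s2_def)
  have s3: "run (NAssign (B+2) (NConst 0)) s2 1 s3"
    using reach_NAssign[of n "descr I" \<O> "B+2" "NConst 0" s2] by (simp add: s3_def)
  let ?Ps = "map (candidate B m PC PL) (sign_lists m)"
  let ?S = "\<lambda>i. (\<lambda>bs. points m bs ?k) ` set (take i (sign_lists m))"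
  let ?Inv = "\<lambda>i (t :: store). nreg t B = n \<and> nreg t (B+1) = ?k \<and> best_of ?k t (?S i)"
  have "\<exists>s'. run (seq_list ?Ps) s3 (1 + length ?Ps * candidate_time m TC TL n) s' \<and> ?Inv (length ?Ps) s'"
  proof (rule reach_seq_list[where Inv = ?Inv])
    show "?Inv 0 s3" by (simp add: s3_def s2_def s1_def best_of_def)
  next
    fix i t assume i: "i < length ?Ps" and inv: "?Inv i t"
    obtain t' where t': "run (?Ps ! i) t (candidate_time m TC TL n) t'" "nreg t' B = n" "nreg t' (B+1) = ?k"
      "best_of ?k t' (insert (points m (sign_lists m ! i) ?k) (?S i))"
      using run_candidate[of t ?k m "?S i" "sign_lists m ! i"] inv l m i
      by (metis diff_le_self le_simps(3) length_map nth_map zero_less_diff One_nat_def)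
    then have "?Inv (Suc i) t'" using i by (simp add: take_Suc_conv_app_nth)
    then show "\<exists>s'. run (?Ps ! i) t (candidate_time m TC TL n) s' \<and> ?Inv (Suc i) s'" using t'(1) by blast
  qed
  then obtain s4 where s4: "run (seq_list ?Ps) s3 (1 + length (sign_lists m) * candidate_time m TC TL n) s4"
    "nreg s4 B = n" "nreg s4 (B+1) = ?k" "best_of ?k s4 ((\<lambda>bs. points m bs ?k) ` set (sign_lists m))" by auto
  define xs where "xs = rows_at n s4 (B+2) ?k"
  obtain ys where ys: "ys \<in> solutions I ?k" "objective I ys = opt I ?k" using opt_attained by blast
  obtain bs where bs: "bs \<in> set (sign_lists m)" "points m bs ?k = ys" using points_surj[OF ys(1) order_trans[OF diff_le_self m] m] by auto
  have xs: "xs \<in> (\<lambda>bs. points m bs ?k) ` set (sign_lists m)" "objective I xs \<le> objective I ys"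
    using s4(4) bs by (auto simp: best_of_def xs_def split: if_splits)
  have "set xs \<subseteq> feas I" using xs(1) set_points by blast
  then have sol: "xs \<in> solutions I ?k" by (simp add: solutions_def xs_def)
  have obj: "objective I xs = opt I ?k" using xs(2) ys(2) opt_le[OF sol] by simp
  obtain s5 where s5: "run (copy_cells (B+3) 0 (NConst 0) (B+2) (NConst 0) (NMul (NReg (B+1)) (NReg B))) s4 (2 + (?k * n) * 3) s5"
      "\<And>x. x < ?k * n \<Longrightarrow> arr s5 0 x = arr s4 (B+2) x"
    using reach_copy_cells[of "B+2" 0 "B+3" s4 "NConst 0" 0 "NConst 0" 0 "NMul (NReg (B+1)) (NReg B)" "?k * n" n "descr I" \<O>] s4
    by auto
  have "rows_at n s5 0 ?k = xs" unfolding xs_def by (rule rows_at_cong) (use s5(2) in simp)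
  moreover have "run (small_case B m l PC PL) s (small_time m TC TL n) s5"
    unfolding small_case_def
  proof (rule reach_mono[OF reach_Seq[OF s1 reach_Seq[OF s2 reach_Seq[OF s3 reach_Seq[OF s4(1) s5(1)]]]]])
    have "?k * n \<le> n * n" by simp
    then show "1 + (1 + (1 + (1 + length (sign_lists m) * candidate_time m TC TL n + (2 + ?k * n * 3)))) \<le> small_time m TC TL n"
      by (simp add: small_time_def)
  qed
  ultimately show ?thesis using sol obj by auto
qed

end

section \<open>Polynomial time bounds and the choice of the constants\<close>

lemma computes_iff_reach:
  "computes P q I pre post \<longleftrightarrow> (\<forall>\<O> s. valid_oracle I \<O> \<and> nreg s 0 = inst_dim I \<and> pre s \<longrightarrow>
     (\<exists>s'. reach (inst_dim I) (descr I) \<O> P s (poly q (inst_dim I)) s' \<and> post s s'))"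
  unfolding computes_def reach_def by (intro iff_allI) blast

text \<open>Lets the closure rules recognise the composite time bound by its structure. All
  subprograms run in the same dimension \<open>n\<close>, so sums and products suffice.\<close>

definition polynomial_fun :: "(nat \<Rightarrow> nat) \<Rightarrow> bool" where
  "polynomial_fun f \<longleftrightarrow> (\<exists>q. f = poly q)"

lemma polynomial_funE:
  assumes "polynomial_fun f"
  obtains q where "\<And>n. poly q n = f n"
  using assms by (auto simp: polynomial_fun_def)

lemma polynomial_fun_poly: "polynomial_fun (\<lambda>n. poly q n)"
  and polynomial_fun_const: "polynomial_fun (\<lambda>n. c)"
  and polynomial_fun_id: "polynomial_fun (\<lambda>n. n)"
  and polynomial_fun_add: "polynomial_fun f \<Longrightarrow> polynomial_fun g \<Longrightarrow> polynomial_fun (\<lambda>n. f n + g n)"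
  and polynomial_fun_mult: "polynomial_fun f \<Longrightarrow> polynomial_fun g \<Longrightarrow> polynomial_fun (\<lambda>n. f n * g n)"
proof -
  show "polynomial_fun (\<lambda>n. poly q n)" by (auto simp: polynomial_fun_def)
  show "polynomial_fun (\<lambda>n. c)" unfolding polynomial_fun_def by (rule exI[of _ "[:c:]"]) (simp add: fun_eq_iff)
  show "polynomial_fun (\<lambda>n. n)" unfolding polynomial_fun_def by (rule exI[of _ "[:0, 1:]"]) (simp add: fun_eq_iff)
  assume "polynomial_fun f" "polynomial_fun g"
  then obtain p q where "f = poly p" "g = poly q" by (auto simp: polynomial_fun_def)
  then show "polynomial_fun (\<lambda>n. f n + g n)" "polynomial_fun (\<lambda>n. f n * g n)"
    unfolding polynomial_fun_def by (intro exI[of _ "p + q"], simp add: fun_eq_iff, intro exI[of _ "p * q"], simp add: fun_eq_iff)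
qed

text \<open>For \<open>n \<ge> 2 * l + 1\<close>, \<open>n - l + 1\<close> is at least
  \<open>n / 2\<close>; this gives the factor 2 in \<open>K\<close>. The loss is then at most
  \<open>K * real n powr (- \<delta>)\<close>, which tends to 0 as \<delta> is positive.\<close>

lemma greedy_loss_small:
  fixes M C \<delta> \<epsilon> :: real and l :: nat
  assumes "0 \<le> M" "0 < C" "0 < \<delta>" "0 < \<epsilon>"
  shows "\<exists>m. \<forall>n\<ge>m. real l * (M * (C * real n powr (1 - \<delta>)) / real (n - l + 1)) \<le> \<epsilon>"
proof -
  define K where "K = 2 * real l * M * C"
  have K: "0 \<le> K" using assms by (simp add: K_def)
  have "(\<lambda>n. real n powr (- \<delta>)) \<longlonglongrightarrow> 0"
    by (rule tendsto_neg_powr[OF _ filterlim_real_sequentially]) (use assms in simp)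
  then have "(\<lambda>n. K * real n powr (- \<delta>)) \<longlonglongrightarrow> 0" by (rule tendsto_mult_right_zero)
  then have "eventually (\<lambda>n. K * real n powr (- \<delta>) < \<epsilon>) sequentially"
    by (rule order_tendstoD) (use assms in simp)
  then obtain N where N: "\<And>n. n \<ge> N \<Longrightarrow> K * real n powr (- \<delta>) < \<epsilon>"
    by (auto simp: eventually_sequentially)
  show ?thesis
  proof (intro exI[of _ "max N (2 * l + 1)"] allI impI)
    fix n assume n: "max N (2 * l + 1) \<le> n"
    have pos: "0 < real n" using n by simp
    have half: "real n / 2 \<le> real (n - l + 1)" using n by (simp add: of_nat_diff)
    have "real l * (M * (C * real n powr (1 - \<delta>)) / real (n - l + 1))
        \<le> real l * (M * (C * real n powr (1 - \<delta>)) / (real n / 2))"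
      using assms pos half by (intro mult_left_mono divide_left_mono mult_nonneg_nonneg) auto
    also have "\<dots> = K * (real n powr (1 - \<delta>) / real n powr 1)" using pos by (simp add: K_def)
    also have "\<dots> = K * real n powr (- \<delta>)" by (simp only: powr_diff[symmetric]) simp
    also have "\<dots> \<le> \<epsilon>" using N[of n] n by simp
    finally show "real l * (M * (C * real n powr (1 - \<delta>)) / real (n - l + 1)) \<le> \<epsilon>" .
  qed
qed

theorem theorem7:
  fixes \<K> :: "m3_inst set" and M \<delta> C \<epsilon> :: real and l :: nat
  assumes inst: "\<forall>I\<in>\<K>. valid_inst I"
    and lin_max: "lin_max_poly \<K>"
    and m3_n: "m3_n_oracle_poly \<K>"
    and conv_problem: "conv_problem_poly \<K>"
    and \<delta>: "0 < \<delta>" "\<delta> \<le> 1"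
    and C: "0 < C"
    and \<epsilon>: "0 < \<epsilon>"
    and l: "1 \<le> l"
  shows "\<exists>(P :: com) (q :: nat poly). \<forall>\<C> p_lo p_up m.
           \<C> \<subseteq> \<K> \<and> card_bounds \<C> p_lo p_up
           \<and> (\<forall>n\<ge>1. p_up n \<le> C * real n powr (1 - \<delta>)) \<and> cost_bounds \<C> m M
           \<longrightarrow> (\<forall>I\<in>\<C>. l \<le> inst_dim I - 1 \<longrightarrow> approx_solves P q I (inst_dim I - l) \<epsilon>)"
proof -
  obtain PL qL where PL: "\<And>I. I \<in> \<K> \<Longrightarrow> computes PL qL I (\<lambda>s. True)
     (\<lambda>s s'. row_at (inst_dim I) s' 1 0 \<in> unc I \<and>
       (\<forall>c'\<in>unc I. row_at (inst_dim I) s 0 0 \<bullet> c' \<le> row_at (inst_dim I) s 0 0 \<bullet> row_at (inst_dim I) s' 1 0))"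
    using lin_max unfolding lin_max_poly_def Let_def by blast
  obtain PM qM where PM: "\<And>I. I \<in> \<K> \<Longrightarrow> computes PM qM I (\<lambda>s. True)
     (\<lambda>s s'. rows_at (inst_dim I) s' 0 (inst_dim I) \<in> solutions I (inst_dim I) \<and>
       objective I (rows_at (inst_dim I) s' 0 (inst_dim I)) = opt I (inst_dim I))"
    using m3_n unfolding m3_n_oracle_poly_def Let_def by blast
  obtain PC qC where PC: "\<And>I. I \<in> \<K> \<Longrightarrow> computes PC qC I
     (\<lambda>s. 1 \<le> nreg s 1 \<and> nreg s 1 \<le> inst_dim I \<and> set (rows_at (inst_dim I) s 0 (nreg s 1)) \<subseteq> feas I)
     (\<lambda>s s'. row_at (inst_dim I) s' 1 0 \<in> conv_vecs (inst_dim I) (rows_at (inst_dim I) s 0 (nreg s 1)) \<and>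
       (\<forall>y\<in>conv_vecs (inst_dim I) (rows_at (inst_dim I) s 0 (nreg s 1)). max_cost I (row_at (inst_dim I) s' 1 0) \<le> max_cost I y))"
    using conv_problem unfolding conv_problem_poly_def Let_def by blast
  \<comment> \<open>The numbers 0 and 1 keep the registers and arrays used for input and output
    below \<open>B\<close>.\<close>
  define W where "W = {0, 1} \<union> wregs PL \<union> wregs PM \<union> wregs PC \<union> warrs PL \<union> warrs PM \<union> warrs PC"
  have "finite W" by (simp add: W_def finite_wregs finite_warrs)
  then obtain B where W: "W \<subseteq> {..<B}" unfolding finite_nat_iff_bounded by blast
  \<comment> \<open>The threshold must be chosen before any class is given, while
    \<open>0 \<le> M\<close> follows only from the cost bounds of a class; hence
    \<open>max M 0\<close>.\<close>
  obtain m where m: "\<And>n. n \<ge> m \<Longrightarrow> real l * (max M 0 * (C * real n powr (1 - \<delta>)) / real (n - l + 1)) \<le> \<epsilon>"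
    using greedy_loss_small[of "max M 0" C \<delta> \<epsilon> l] C \<delta> \<epsilon> by auto
  define P where "P = Cond (NLess (NReg 0) (NConst m)) (small_case B m l PC PL) (large_case B l PM PC PL)"
  \<comment> \<open>The number of sign lists is exponential in \<open>m * m\<close>, but
    \<open>m\<close> is fixed, so it enters as a constant. Adding both times covers either branch,
    and the 1 pays for the test between them.\<close>
  have "polynomial_fun (\<lambda>n. 1 + small_time m (poly qC n) (poly qL n) n + large_time l (poly qM n) (poly qC n) (poly qL n) n)"
    unfolding small_time_def large_time_def candidate_time_def greedy_time_def trial_time_def eval_time_def
    by (intro polynomial_fun_add polynomial_fun_mult polynomial_fun_const polynomial_fun_id polynomial_fun_poly)
  then obtain q where q: "\<And>n. poly q n = 1 + small_time m (poly qC n) (poly qL n) n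
      + large_time l (poly qM n) (poly qC n) (poly qL n) n"
    by (rule polynomial_funE) blast
  have "approx_solves P q I (inst_dim I - l) \<epsilon>"
    if \<C>: "\<C> \<subseteq> \<K>" "card_bounds \<C> p_lo p_up" "\<forall>n\<ge>1. p_up n \<le> C * real n powr (1 - \<delta>)" "cost_bounds \<C> m' M"
      and I: "I \<in> \<C>" "l \<le> inst_dim I - 1" for \<C> p_lo p_up m' I
  proof -
    define n where "n = inst_dim I"
    have IK: "I \<in> \<K>" using \<C> I by auto
    have n1: "1 \<le> n" using inst IK by (auto simp: valid_inst_def n_def)
    have ln: "l < n" using I(2) n1 by (simp add: n_def)
    have M: "0 \<le> M" "max M 0 = M" using \<C>(4) by (auto simp: cost_bounds_def)
    have cost: "norm_inf c \<le> M" if "c \<in> unc I" for c using \<C>(4) I(1) that by (auto simp: cost_bounds_def)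
    have card: "real (norm0 x) \<le> C * real n powr (1 - \<delta>)" if "x \<in> feas I" for x
      using \<C>(2,3) I(1) that n1 unfolding card_bounds_def n_def by (meson order_trans)
    have "\<exists>s'. reach n (descr I) \<O> P s (poly q n) s' \<and> rows_at n s' 0 (n - l) \<in> solutions I (n - l)
       \<and> objective I (rows_at n s' 0 (n - l)) \<le> opt I (n - l) + \<epsilon>"
      if \<O>: "valid_oracle I \<O>" and s: "nreg s 0 = n" for \<O> s
    proof -
      interpret program_ctxt I n \<O> B "poly qC n" "poly qL n" PC PL
      proof
        show "2 \<le> B" using W by (auto simp: W_def)
        show "wregs PC \<subseteq> {..<B}" "wregs PL \<subseteq> {..<B}" "warrs PC \<subseteq> {..<B}" "warrs PL \<subseteq> {..<B}"
          using W by (auto simp: W_def)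
        show "valid_inst I" using inst IK by blast
      qed (use \<O> PC[OF IK] PL[OF IK] in \<open>simp_all add: computes_iff_reach flip: n_def\<close>)
      show ?thesis
      proof (cases "n < m")
        case True
        obtain s' where s': "run (small_case B m l PC PL) s (small_time m (poly qC n) (poly qL n) n) s'"
          "rows_at n s' 0 (n - l) \<in> solutions I (n - l)" "objective I (rows_at n s' 0 (n - l)) = opt I (n - l)"
          using run_small_case[OF s ln] True by (meson less_imp_le)
        have "run P s (poly q n) s'" unfolding P_def
          by (rule reach_mono[OF reach_CondTrue[OF _ s'(1)]]) (use True s q in auto)
        then show ?thesis using s' \<epsilon> by auto
      next
        case False
        have "\<exists>s'. run PM s (poly qM n) s' \<and> rows_at n s' 0 n \<in> solutions I n
            \<and> objective I (rows_at n s' 0 n) = opt I n" if "nreg s 0 = n" for s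
          using PM[OF IK] \<O> that by (simp add: computes_iff_reach flip: n_def)
        moreover have "wregs PM \<subseteq> {..<B}" "warrs PM \<subseteq> {..<B}" using W by (auto simp: W_def)
        ultimately obtain s' where s': "run (large_case B l PM PC PL) s (large_time l (poly qM n) (poly qC n) (poly qL n) n) s'"
          "rows_at n s' 0 (n - l) \<in> solutions I (n - l)"
          "objective I (rows_at n s' 0 (n - l)) \<le> opt I n + real l * (M * (C * real n powr (1 - \<delta>)) / real (n - l + 1))"
          using run_large_case[OF _ _ _ s ln M(1) cost card] by meson
        have "opt I n \<le> opt I (n - l)" by (rule opt_antimono) (use ln in auto)
        then have "objective I (rows_at n s' 0 (n - l)) \<le> opt I (n - l) + \<epsilon>"
          using s'(3) m[of n] False M(2) by simp
        moreover have "run P s (poly q n) s'" unfolding P_def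
          by (rule reach_mono[OF reach_CondFalse[OF _ s'(1)]]) (use False s q in auto)
        ultimately show ?thesis using s'(2) by blast
      qed
    qed
    then show ?thesis by (simp add: approx_solves_def computes_iff_reach Let_def flip: n_def)
  qed
  then show ?thesis by blast
qed

end
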